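(* Let $\mu>1$, let $\boldsymbol{\gamma}=(\gamma_j)_{j\in\mathbb{N}}$ be a sequence of positive real numbers, assume that $\kappa\ge\sup_{j\in\mathbb{N}}\max\{\exp(\mathrm{e}^2),\exp(\mathrm{e}^2\gamma_j^{1/\mu})\}$, and assume that for some $1/\mu<\lambda\le1$ we have $$\Gamma:=\sum_{j=1}^\infty\gamma_j\max\{1,\log\gamma_j^{-1}\}^{\mu(1-\lambda)}<\infty.$$ Then there is a constant $c>0$ depending only on $\mu,\lambda,\kappa,\Gamma$ (in particular independent of the dimension $s$ and of $N$) such that for every $s\in\mathbb{N}$, every prime $N$, and every generating vector $\boldsymbol{g}^\ast\in\{1,\ldots,N-1\}^s$ constructed by the component-by-component algorithm, the worst-case error in the space $H_{K_{\log,\mu,\boldsymbol{\gamma}}}$ satisfies $$e^2(\boldsymbol{g}^\ast)\le\frac{c}{N(\log N)^{\mu(1-\lambda)}}.$$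
   Context: $\log$ denotes the natural logarithm. $\log$-Korobov space. For $\mu>1$, positive weights $\boldsymbol{\gamma}=(\gamma_j)_{j\in\mathbb{N}}$ and a real $\kappa$ with $\kappa\ge\max\{\exp(\mathrm{e}^2),\exp(\mathrm{e}^2\gamma_j^{1/\mu})\}$ for all $j$, define for $k\in\mathbb{Z}$: $r_{\mu,\gamma}(0)=1$ and $r_{\mu,\gamma}(k)=\gamma|k|^{-1}(\log(\kappa|k|))^{-\mu}$ if $k\ne0$; for $\boldsymbol{k}\in\mathbb{Z}^s$ put $r_{\mu,\boldsymbol{\gamma}}(\boldsymbol{k})=\prod_{j=1}^s r_{\mu,\gamma_j}(k_j)$. The $\log$-Korobov space $H_{K_{\log,\mu,\boldsymbol{\gamma}}}$ (in dimension $s$) is the reproducing kernel Hilbert space of functions on $[0,1]^s$ with kernel $K_{\log,\mu,\boldsymbol{\gamma}}(\boldsymbol{x},\boldsymbol{y})=\sum_{\boldsymbol{k}\in\mathbb{Z}^s}r_{\mu,\boldsymbol{\gamma}}(\boldsymbol{k})\mathrm{e}^{2\pi\mathrm{i}\boldsymbol{k}\cdot(\boldsymbol{x}-\boldsymbol{y})}$ and inner product $\langle f,g\rangle=\sum_{\boldsymbol{k}\in\mathbb{Z}^s}\widehat f(\boldsymbol{k})\overline{\widehat g(\boldsymbol{k})}\,r_{\mu,\boldsymbol{\gamma}}^{-1}(\boldsymbol{k})$, where $\widehat f(\boldsymbol{k})=\int_{[0,1]^s}f(\boldsymbol{x})\mathrm{e}^{-2\pi\mathrm{i}\boldsymbol{k}\cdot\boldsymbol{x}}\,\mathrm{d}\boldsymbol{x}$.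 Worst-case error of a lattice rule. For a Hilbert space $H$ of functions on $[0,1]^s$ and points $P=\{\boldsymbol{x}_0,\ldots,\boldsymbol{x}_{N-1}\}$, $e(H,P)=\sup_{\|f\|_H\le1}\left|\int_{[0,1]^s}f(\boldsymbol{x})\,\mathrm{d}\boldsymbol{x}-\frac1N\sum_{n=0}^{N-1}f(\boldsymbol{x}_n)\right|$. For $N$ prime and $\boldsymbol{g}=(g_1,\ldots,g_d)\in\{1,\ldots,N-1\}^d$, the lattice point set with generating vector $\boldsymbol{g}$ consists of $\boldsymbol{x}_n=(\{ng_1/N\},\ldots,\{ng_d/N\})$, $0\le n\le N-1$, with $\{\cdot\}$ the fractional part. Write $e(\boldsymbol{g})$ for the worst-case error in the $d$-dimensional space $H_{K_{\log,\mu,\boldsymbol{\gamma}}}$ of this lattice rule; one has $e^2(\boldsymbol{g})=\sum_{\boldsymbol{k}\in L^\perp\setminus\{\boldsymbol{0}\}}r_{\mu,\boldsymbol{\gamma}}(\boldsymbol{k})$ with $L^\perp=\{\boldsymbol{\ell}\in\mathbb{Z}^d:\boldsymbol{\ell}\cdot\boldsymbol{g}\equiv0\pmod N\}$. Component-by-component algorithm. Given $s\in\mathbb{N}$ and a prime $N$: set $g_1^\ast=1$; for $d=1,\ldots,s-1$, with $g_1^\ast,\ldots,g_d^\ast$ already found, choose $g_{d+1}^\ast\in\{1,\ldots,N-1\}$ minimizing $g\mapsto e^2(g_1^\ast,\ldots,g_d^\ast,g)$ over $g\in\{1,\ldots,N-1\}$. *)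

theory Defs
  imports "HOL-Probability.Probability" "HOL-Computational_Algebra.Primes"
begin

(* Points of [0,1]^s and frequencies in Z^s are functions on nat whose coordinates are indexed
   by 1, ..., s (and which are undefined elsewhere, as usual for PiE). *)

definition cube_measure :: "nat \<Rightarrow> (nat \<Rightarrow> real) measure" where
  "cube_measure s = Pi\<^sub>M {1..s} (\<lambda>_. restrict_space lborel {0..1})"

definition unit_cube :: "nat \<Rightarrow> (nat \<Rightarrow> real) set" where
  "unit_cube s = {1..s} \<rightarrow>\<^sub>E {0..1}"

definition freqs :: "nat \<Rightarrow> (nat \<Rightarrow> int) set" where
  "freqs s = {1..s} \<rightarrow>\<^sub>E UNIV"

definition fourier_coeff :: "nat \<Rightarrow> ((nat \<Rightarrow> real) \<Rightarrow> complex) \<Rightarrow> (nat \<Rightarrow> int) \<Rightarrow> complex" where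
  "fourier_coeff s f k =
     (\<integral>x. f x * cis (- 2 * pi * (\<Sum>j=1..s. real_of_int (k j) * x j)) \<partial>cube_measure s)"

definition korobov_r1 :: "real \<Rightarrow> real \<Rightarrow> real \<Rightarrow> int \<Rightarrow> real" where
  "korobov_r1 \<kappa> \<mu> c k =
     (if k = 0 then 1 else c * inverse \<bar>real_of_int k\<bar> * ln (\<kappa> * \<bar>real_of_int k\<bar>) powr (- \<mu>))"

definition korobov_r :: "real \<Rightarrow> real \<Rightarrow> (nat \<Rightarrow> real) \<Rightarrow> nat \<Rightarrow> (nat \<Rightarrow> int) \<Rightarrow> real" where
  "korobov_r \<kappa> \<mu> \<gamma> s k = (\<Prod>j=1..s. korobov_r1 \<kappa> \<mu> (\<gamma> j) (k j))"

definition log_korobov_kernel ::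
  "real \<Rightarrow> real \<Rightarrow> (nat \<Rightarrow> real) \<Rightarrow> nat \<Rightarrow> (nat \<Rightarrow> real) \<Rightarrow> (nat \<Rightarrow> real) \<Rightarrow> complex" where
  "log_korobov_kernel \<kappa> \<mu> \<gamma> s x y =
     (\<Sum>\<^sub>\<infinity>k\<in>freqs s. of_real (korobov_r \<kappa> \<mu> \<gamma> s k) *
        cis (2 * pi * (\<Sum>j=1..s. real_of_int (k j) * (x j - y j))))"

definition log_korobov_inner ::
  "real \<Rightarrow> real \<Rightarrow> (nat \<Rightarrow> real) \<Rightarrow> nat \<Rightarrow>
     ((nat \<Rightarrow> real) \<Rightarrow> complex) \<Rightarrow> ((nat \<Rightarrow> real) \<Rightarrow> complex) \<Rightarrow> complex" where
  "log_korobov_inner \<kappa> \<mu> \<gamma> s f g =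
     (\<Sum>\<^sub>\<infinity>k\<in>freqs s. fourier_coeff s f k * cnj (fourier_coeff s g k) *
        of_real (inverse (korobov_r \<kappa> \<mu> \<gamma> s k)))"

definition log_korobov_norm ::
  "real \<Rightarrow> real \<Rightarrow> (nat \<Rightarrow> real) \<Rightarrow> nat \<Rightarrow> ((nat \<Rightarrow> real) \<Rightarrow> complex) \<Rightarrow> real" where
  "log_korobov_norm \<kappa> \<mu> \<gamma> s f = sqrt (Re (log_korobov_inner \<kappa> \<mu> \<gamma> s f f))"

(* The reproducing kernel Hilbert space with the above kernel and inner product, as a set of
   functions: all integrable functions of finite norm for which the kernel reproduces every
   point value on the cube.  Any Hilbert space with this inner product and this reproducing
   kernel is contained in this set.  Conversely, as the kernel section at x has k-th Fourier
   coefficient r(k) cis (- 2 pi k.x), the last condition says that f is on the whole cube the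
   (absolutely convergent) sum of its Fourier series, so that the set is isometric to the
   weighted l2 space of Fourier coefficients, contains all kernel sections, and hence is the
   reproducing kernel Hilbert space itself.  Values outside the cube are irrelevant. *)
definition log_korobov_space ::
  "real \<Rightarrow> real \<Rightarrow> (nat \<Rightarrow> real) \<Rightarrow> nat \<Rightarrow> ((nat \<Rightarrow> real) \<Rightarrow> complex) set" where
  "log_korobov_space \<kappa> \<mu> \<gamma> s =
     {f. integrable (cube_measure s) f \<and>
         (\<lambda>k. (cmod (fourier_coeff s f k))\<^sup>2 * inverse (korobov_r \<kappa> \<mu> \<gamma> s k)) summable_on freqs s \<and>
         (\<forall>x\<in>unit_cube s.
            f x = log_korobov_inner \<kappa> \<mu> \<gamma> s f (\<lambda>y. log_korobov_kernel \<kappa> \<mu> \<gamma> s y x))}"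

definition worst_case_error ::
  "nat \<Rightarrow> ((nat \<Rightarrow> real) \<Rightarrow> complex) set \<Rightarrow> (((nat \<Rightarrow> real) \<Rightarrow> complex) \<Rightarrow> real) \<Rightarrow>
     nat \<Rightarrow> (nat \<Rightarrow> nat \<Rightarrow> real) \<Rightarrow> real" where
  "worst_case_error s H nrm N p =
     (SUP f\<in>{f\<in>H. nrm f \<le> 1}.
        cmod ((\<integral>x. f x \<partial>cube_measure s) - (1 / of_nat N) * (\<Sum>n<N. f (p n))))"

definition lattice_point :: "nat \<Rightarrow> nat \<Rightarrow> (nat \<Rightarrow> nat) \<Rightarrow> nat \<Rightarrow> nat \<Rightarrow> real" where
  "lattice_point s N g n = (\<lambda>j\<in>{1..s}. frac (real n * real (g j) / real N))"

definition lattice_error ::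
  "real \<Rightarrow> real \<Rightarrow> (nat \<Rightarrow> real) \<Rightarrow> nat \<Rightarrow> nat \<Rightarrow> (nat \<Rightarrow> nat) \<Rightarrow> real" where
  "lattice_error \<kappa> \<mu> \<gamma> s N g =
     worst_case_error s (log_korobov_space \<kappa> \<mu> \<gamma> s) (log_korobov_norm \<kappa> \<mu> \<gamma> s)
       N (lattice_point s N g)"

(* g is a possible outcome of the component-by-component algorithm; minimizers need not be
   unique, so this is a predicate.  In dimension d + 1 only g 1, ..., g (d + 1) matter. *)
definition cbc_generated ::
  "real \<Rightarrow> real \<Rightarrow> (nat \<Rightarrow> real) \<Rightarrow> nat \<Rightarrow> nat \<Rightarrow> (nat \<Rightarrow> nat) \<Rightarrow> bool" where
  "cbc_generated \<kappa> \<mu> \<gamma> s N g \<longleftrightarrow>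
     g \<in> {1..s} \<rightarrow>\<^sub>E {1..N - 1} \<and> g 1 = 1 \<and>
     (\<forall>d\<in>{1..<s}. \<forall>h\<in>{1..N - 1}.
        (lattice_error \<kappa> \<mu> \<gamma> (d + 1) N g)\<^sup>2 \<le>
        (lattice_error \<kappa> \<mu> \<gamma> (d + 1) N (g(d + 1 := h)))\<^sup>2)"

end

theory Submission
  imports Defs "HOL-Library.Real_Mod"
begin

text \<open>
  The squared worst-case error is the sum of the weights \<open>r(k)\<close> over the nonzero frequencies
  of the dual lattice (\<open>lattice_error_sq_eq_dual_sum\<close>): a function of the space is the sum of its
  absolutely convergent Fourier series, the only characters that the rule does not integrate
  exactly are those with a nonzero frequency in the dual lattice, and Cauchy--Schwarz, with its extremal function, gives
  the norm of the remaining error functional.  Hence the step from dimension \<open>d\<close> to \<open>d + 1\<close> adds to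
  the squared error the sum over the dual frequencies with nonzero last component, and the
  algorithm minimizes exactly this increment.

  The minimum is to be compared with an average over the candidates, but the plain average of the
  increments is only of order \<open>1 / N\<close>.  The logarithms come from averaging after applying
  \<open>\<phi>(x) = x max(M, ln(1/x))^A\<close> with \<open>A = \<mu> (1 - \<lambda>)\<close>, in the way Jensen's inequality
  is used with powers for polynomially decaying weights.  The following properties of \<open>\<phi>\<close> are
  used.  It is increasing as \<open>M \<ge> A\<close>, so it can be applied to the minimum.  The factor
  \<open>\<phi>(x) / x\<close> is decreasing, so \<open>\<phi>\<close> is countably subadditive.  It is
  submultiplicative as \<open>M \<ge> 2\<close>, so that \<open>\<phi>(r(k))\<close> is dominated by a product of
  one-dimensional weights; these are of order
  \<open>\<gamma> max(1, ln(1/\<gamma>))^A / (|m| ln(\<kappa> |m|)^(\<mu> \<lambda>))\<close> and are still summable since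
  \<open>\<mu> \<lambda> > 1\<close>.

  Averaging these dominating weights over the candidates is a counting problem: a last component
  that is not a multiple of \<open>N\<close> fits at most one candidate, and the multiples of \<open>N\<close> carry at most
  \<open>1 / N\<close> of the total mass (\<open>sum_new_sum_le\<close>).  If \<open>\<sigma>\<^sub>j\<close> is the total mass of the
  \<open>j\<close>-th weight off zero, the \<open>\<phi>\<close>-value of the increment in component \<open>d + 1\<close> is thus
  at most a multiple of \<open>\<sigma>\<^sub>d\<^sub>+\<^sub>1 (1 + \<sigma>\<^sub>1) \<dots> (1 + \<sigma>\<^sub>d) / N\<close>.  These bounds telescope,
  whence \<open>\<phi>(e\<^sup>2)\<close> is at most a multiple of
  \<open>(1 + \<sigma>\<^sub>1) \<dots> (1 + \<sigma>\<^sub>s) / N\<close> (\<open>greedy_dual_sum_bound\<close>).  The product is at most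
  \<open>exp(\<sigma>\<^sub>1 + \<dots> + \<sigma>\<^sub>s)\<close>, which the assumption on the weights bounds independently
  of \<open>s\<close>.  Inverting \<open>\<phi>\<close> produces the logarithmic gain.
\<close>

section \<open>Products of one-dimensional weights\<close>

definition prod_weight :: "(nat \<Rightarrow> int \<Rightarrow> real) \<Rightarrow> nat \<Rightarrow> (nat \<Rightarrow> int) \<Rightarrow> real" where
  "prod_weight \<rho> d k = (\<Prod>j=1..d. \<rho> j (k j))"

lemma prod_weight_Suc: "prod_weight \<rho> (Suc d) k = prod_weight \<rho> d k * \<rho> (Suc d) (k (Suc d))"
  by (simp add: prod_weight_def)

lemma prod_weight_upd [simp]: "prod_weight \<rho> d (k(Suc d := m)) = prod_weight \<rho> d k"
  by (simp add: prod_weight_def)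

lemma prod_weight_nonneg: "(\<And>j m. j \<in> {1..d} \<Longrightarrow> \<rho> j m \<ge> 0) \<Longrightarrow> prod_weight \<rho> d k \<ge> 0"
  by (auto simp: prod_weight_def intro!: prod_nonneg)

text \<open>
  Frequencies are undefined outside \<open>{1..d}\<close>, so appending a component is injective.
\<close>

lemma bij_betw_freqs_Suc:
  "bij_betw (\<lambda>(k, m). k(Suc d := m)) (freqs d \<times> UNIV) (freqs (Suc d))"
  unfolding bij_betw_def
proof
  have ext: "k (Suc d) = undefined" if "k \<in> freqs d" for k
    using that by (auto simp: freqs_def PiE_def extensional_def)
  show "inj_on (\<lambda>(k, m). k(Suc d := m)) (freqs d \<times> UNIV)"
  proof (rule inj_onI, clarify)
    fix k m k' m' assume *: "k \<in> freqs d" "k' \<in> freqs d" "k(Suc d := m) = k'(Suc d := m')"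
    have "k j = k' j" for j
      using fun_cong[OF *(3), of j] ext[OF *(1)] ext[OF *(2)] by (cases "j = Suc d") auto
    thus "k = k' \<and> m = m'" using fun_cong[OF *(3), of "Suc d"] by auto
  qed
  have "{1..Suc d} = insert (Suc d) {1..d}" by auto
  hence "freqs (Suc d) = (\<lambda>(m, k). k(Suc d := m)) ` (UNIV \<times> freqs d)"
    by (simp add: freqs_def PiE_insert_eq)
  also have "\<dots> = (\<lambda>(k, m). k(Suc d := m)) ` (freqs d \<times> UNIV)"
    by auto
  finally show "(\<lambda>(k, m). k(Suc d := m)) ` (freqs d \<times> UNIV) = freqs (Suc d)" ..
qed

text \<open>
  Fubini for nonnegative product weights.  It serves twice: with the space's own weights it makes
  the error series converge, and with a modified last factor it bounds the average over the
  candidates for a new component.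
\<close>

lemma has_sum_prod_weight:
  assumes "\<And>j. j \<in> {1..d} \<Longrightarrow> (\<rho> j has_sum S j) UNIV" and "\<And>j m. j \<in> {1..d} \<Longrightarrow> \<rho> j m \<ge> 0"
  shows "(prod_weight \<rho> d has_sum (\<Prod>j=1..d. S j)) (freqs d)"
  using assms
proof (induction d)
  case 0
  show ?case by (simp add: freqs_def prod_weight_def has_sum_finite_iff)
next
  case (Suc d)
  let ?f = "\<lambda>(k, m). prod_weight \<rho> d k * \<rho> (Suc d) m"
  have IH: "(prod_weight \<rho> d has_sum (\<Prod>j=1..d. S j)) (freqs d)"
    using Suc by auto
  have last: "(\<rho> (Suc d) has_sum S (Suc d)) UNIV" using Suc by auto
  have nn: "prod_weight \<rho> d k \<ge> 0" for k using Suc.prems by (intro prod_weight_nonneg) auto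
  have 1: "((\<lambda>m. ?f (k, m)) has_sum prod_weight \<rho> d k * S (Suc d)) UNIV" for k
    using has_sum_cmult_right[OF last] by simp
  have 2: "((\<lambda>k. prod_weight \<rho> d k * S (Suc d)) has_sum (\<Prod>j=1..d. S j) * S (Suc d)) (freqs d)"
    by (rule has_sum_cmult_left[OF IH])
  have "(?f has_sum (\<Prod>j=1..d. S j) * S (Suc d)) (Sigma (freqs d) (\<lambda>_. UNIV))"
  proof (rule has_sum_SigmaI[OF 1 2])
    show "?f summable_on freqs d \<times> UNIV"
      by (rule summable_on_SigmaI[OF 1]) (use 2 nn Suc.prems in \<open>auto simp: has_sum_imp_summable\<close>)
  qed
  also have "?f = (\<lambda>x. prod_weight \<rho> (Suc d) ((\<lambda>(k, m). k(Suc d := m)) x))"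
    by (auto simp: prod_weight_Suc)
  finally have "((\<lambda>x. prod_weight \<rho> (Suc d) ((\<lambda>(k, m). k(Suc d := m)) x)) has_sum
      (\<Prod>j=1..Suc d. S j)) (freqs d \<times> UNIV)" by simp
  thus ?case by (subst (asm) has_sum_reindex_bij_betw[OF bij_betw_freqs_Suc])
qed

lemma has_sum_finite_sum:
  fixes f :: "'i \<Rightarrow> 'a \<Rightarrow> 'b::{topological_comm_monoid_add, t2_space}"
  assumes "finite I" and "\<And>i. i \<in> I \<Longrightarrow> f i summable_on K"
  shows "((\<lambda>k. \<Sum>i\<in>I. f i k) has_sum (\<Sum>i\<in>I. infsum (f i) K)) K"
  using assms by (induction I rule: finite_induct) (auto intro!: has_sum_add)

section \<open>Trigonometric series on the unit cube\<close>

definition trig :: "nat \<Rightarrow> (nat \<Rightarrow> int) \<Rightarrow> (nat \<Rightarrow> real) \<Rightarrow> complex" where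
  "trig s k x = cis (2 * pi * (\<Sum>j=1..s. real_of_int (k j) * x j))"

lemma norm_trig [simp]: "norm (trig s k x) = 1"
  by (simp add: trig_def)

lemma cnj_trig: "cnj (trig s k x) = cis (- 2 * pi * (\<Sum>j=1..s. real_of_int (k j) * x j))"
  by (simp add: trig_def cis_cnj)

lemma fourier_coeff_trig: "fourier_coeff s f k = (\<integral>x. f x * cnj (trig s k x) \<partial>cube_measure s)"
  by (simp add: fourier_coeff_def cnj_trig)

lemma cis_sum: "finite A \<Longrightarrow> cis (\<Sum>j\<in>A. f j) = (\<Prod>j\<in>A. cis (f j))"
  by (induction A rule: finite_induct) (auto simp: cis_mult[symmetric])

lemma trig_prod: "trig s k x = (\<Prod>j=1..s. cis (2 * pi * real_of_int (k j) * x j))"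
  by (simp add: trig_def cis_sum sum_distrib_left mult.assoc)

lemma trig_minus_kernel:
  "cis (2 * pi * (\<Sum>j=1..s. real_of_int (k j) * (x j - y j))) = trig s k x * cnj (trig s k y)"
  by (simp add: trig_def cis_cnj cis_mult right_diff_distrib sum_subtractf)

lemma trig_mult_cnj: "trig s k x * cnj (trig s l x) = trig s (\<lambda>j. k j - l j) x"
  by (simp add: trig_def cis_cnj cis_mult algebra_simps sum_subtractf sum_distrib_left)

text \<open>
  The primitive \<open>cis (2 \<pi> m x) / (2 \<pi> i m)\<close> takes the same value at both ends of the interval
  unless \<open>m = 0\<close>.
\<close>

lemma has_bochner_integral_cis_unit_interval:
  "has_bochner_integral (restrict_space lborel {0..1}) (\<lambda>x::real. cis (2 * pi * of_int m * x))
     (if m = 0 then 1 else 0)"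
proof -
  let ?c = "2 * pi * real_of_int m"
  define F where "F x = (if m = 0 then complex_of_real x else cis (?c * x) / (\<i> * of_real ?c))" for x
  have "has_bochner_integral lborel (\<lambda>x. indicator {0..1} x *\<^sub>R cis (?c * x)) (F 1 - F 0)"
  proof (rule has_bochner_integral_FTC_Icc)
    show "continuous_on {0..1} (\<lambda>x. cis (?c * x))"
      unfolding cis_conv_exp by (intro continuous_intros)
    fix x :: real
    show "(F has_vector_derivative cis (?c * x)) (at x within {0..1})"
    proof (cases "m = 0")
      case True
      have "(complex_of_real has_vector_derivative 1) (at x within {0..1})"
        using has_vector_derivative_of_real[OF DERIV_ident] by simp
      thus ?thesis using True by (simp add: F_def[abs_def])
    next
      case False
      have "((\<lambda>x. cis (?c * x) / (\<i> * of_real ?c)) has_vector_derivative cis (?c * x)) (at x within {0..1})"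
        unfolding cis_conv_exp using False
        by (auto intro!: derivative_eq_intros has_vector_derivative_real_field simp: field_simps)
      thus ?thesis using False by (simp add: F_def[abs_def])
    qed
  qed auto
  moreover have "F 1 - F 0 = (if m = 0 then 1 else 0)"
    by (simp add: F_def)
  ultimately show ?thesis
    by (subst has_bochner_integral_restrict_space) auto
qed

interpretation unit_interval: prob_space "restrict_space lborel {0..1::real}"
  by (rule prob_space_restrict_space) auto

interpretation unit_cube: product_sigma_finite "\<lambda>_::nat. restrict_space lborel {0..1::real}"
  by unfold_locales

lemma prob_space_cube_measure: "prob_space (cube_measure s)"
  unfolding cube_measure_def by (rule prob_space_PiM) unfold_locales

lemma integrable_trig: "integrable (cube_measure s) (trig s k)"
  unfolding trig_prod[abs_def] cube_measure_def
  by (rule unit_cube.product_integrable_prod)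
     (use has_bochner_integral_cis_unit_interval in \<open>auto simp: has_bochner_integral_iff\<close>)

lemma integral_trig: "(\<integral>x. trig s k x \<partial>cube_measure s) = (if \<forall>j\<in>{1..s}. k j = 0 then 1 else 0)"
proof -
  have "(\<integral>x. trig s k x \<partial>cube_measure s) = (\<Prod>j=1..s. if k j = 0 then 1 else 0)"
    unfolding trig_prod cube_measure_def
    by (subst unit_cube.product_integral_prod)
       (use has_bochner_integral_cis_unit_interval in \<open>auto simp: has_bochner_integral_iff\<close>)
  also have "\<dots> = (if \<forall>j\<in>{1..s}. k j = 0 then 1 else 0)"
    by (simp add: prod_zero_iff) 
  finally show ?thesis .
qed

lemma freqs_eqI: "k \<in> freqs s \<Longrightarrow> l \<in> freqs s \<Longrightarrow> (\<And>j. j \<in> {1..s} \<Longrightarrow> k j = l j) \<Longrightarrow> k = l"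
  unfolding freqs_def by (rule PiE_ext) auto

lemma fourier_coeff_trig_eq:
  "k \<in> freqs s \<Longrightarrow> l \<in> freqs s \<Longrightarrow> fourier_coeff s (trig s k) l = (if k = l then 1 else 0)"
  using freqs_eqI[of k s l] by (auto simp: fourier_coeff_trig trig_mult_cnj integral_trig)

lemma countable_freqs: "countable (freqs s)"
  unfolding freqs_def by (rule countable_PiE) auto

text \<open>
  Termwise integration over an arbitrary countable index set, reduced to the case of a sequence by
  enumerating the index set and extending by zero, which treats finite and infinite index sets
  alike.
\<close>

lemma (in finite_measure)
  fixes f :: "'i \<Rightarrow> 'a \<Rightarrow> complex"
  assumes K: "countable K" and int: "\<And>k. k \<in> K \<Longrightarrow> integrable M (f k)"
    and bound: "\<And>k x. k \<in> K \<Longrightarrow> norm (f k x) \<le> b k" and sum: "b summable_on K"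
  shows integrable_infsum_bounded: "integrable M (\<lambda>x. \<Sum>\<^sub>\<infinity>k\<in>K. f k x)"
    and integral_infsum_bounded: "(\<integral>x. (\<Sum>\<^sub>\<infinity>k\<in>K. f k x) \<partial>M) = (\<Sum>\<^sub>\<infinity>k\<in>K. \<integral>x. f k x \<partial>M)"
proof -
  let ?I = "to_nat_on K ` K" and ?k = "from_nat_into K"
  define F where "F n x = (if n \<in> ?I then f (?k n) x else 0)" for n x
  define B where "B n = (if n \<in> ?I then b (?k n) else 0)" for n
  have inj: "inj_on (to_nat_on K) K" using K by (rule inj_on_to_nat_on)
  have transfer: "(u has_sum c) K \<longleftrightarrow> ((\<lambda>n. if n \<in> ?I then u (?k n) else 0) has_sum c) UNIV"
    for u :: "'i \<Rightarrow> 'b::{comm_monoid_add,topological_space}" and c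
  proof -
    have "(u has_sum c) K \<longleftrightarrow> ((\<lambda>n. u (?k n)) has_sum c) ?I"
      using K by (subst has_sum_reindex[OF inj], intro has_sum_cong) (auto simp: o_def)
    also have "\<dots> \<longleftrightarrow> ((\<lambda>n. if n \<in> ?I then u (?k n) else 0) has_sum c) UNIV"
      by (rule has_sum_cong_neutral) auto
    finally show ?thesis .
  qed
  have k_mem: "?k n \<in> K" if "n \<in> ?I" for n using that K by auto
  have "(B has_sum infsum b K) UNIV"
    unfolding B_def using transfer has_sum_infsum[OF sum] by blast
  hence B_sum: "summable B" by (meson has_sum_imp_sums sums_summable)
  have F_int: "integrable M (F n)" for n
    unfolding F_def using int[OF k_mem] by (cases "n \<in> ?I") auto
  have F_bound: "norm (F n x) \<le> B n" for n x
    using bound[OF k_mem] by (simp add: F_def B_def)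
  have F_norm: "summable (\<lambda>n. norm (F n x))" for x
    by (rule summable_comparison_test'[OF B_sum, of 0]) (use F_bound in auto)
  have F_norm_int: "summable (\<lambda>n. \<integral>x. norm (F n x) \<partial>M)"
  proof (rule summable_comparison_test')
    show "summable (\<lambda>n. B n * measure M (space M))" by (rule summable_mult2[OF B_sum])
    show "norm (\<integral>x. norm (F n x) \<partial>M) \<le> B n * measure M (space M)" if "0 \<le> n" for n
    proof -
      have "(\<integral>x. norm (F n x) \<partial>M) \<le> (\<integral>x. B n \<partial>M)"
        by (rule integral_mono) (use F_int F_bound in auto)
      thus ?thesis by (simp add: mult.commute)
    qed
  qed
  have f_sum: "(\<lambda>k. f k x) summable_on K" for x
    by (rule abs_summable_summable, rule summable_on_comparison_test[OF sum]) (use bound in auto)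
  have F_suminf: "(\<Sum>n. F n x) = (\<Sum>\<^sub>\<infinity>k\<in>K. f k x)" for x
    using has_sum_infsum[OF f_sum[of x]] unfolding transfer F_def[symmetric]
    by (metis has_sum_imp_sums sums_unique)
  show "integrable M (\<lambda>x. \<Sum>\<^sub>\<infinity>k\<in>K. f k x)"
    using integrable_suminf[of M F] F_int F_norm F_norm_int by (simp add: F_suminf)
  have int_bound: "norm (\<integral>x. f k x \<partial>M) \<le> b k * measure M (space M)" if "k \<in> K" for k
  proof -
    have "norm (\<integral>x. f k x \<partial>M) \<le> (\<integral>x. norm (f k x) \<partial>M)" by simp
    also have "\<dots> \<le> (\<integral>x. b k \<partial>M)"
      by (rule integral_mono) (use int bound that in auto)
    finally show ?thesis by (simp add: mult.commute)
  qed
  have "(\<lambda>k. \<integral>x. f k x \<partial>M) summable_on K"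
    by (rule abs_summable_summable, rule summable_on_comparison_test[OF summable_on_cmult_left[OF sum]])
       (use int_bound in auto)
  from has_sum_infsum[OF this] have "(\<lambda>n. if n \<in> ?I then \<integral>x. f (?k n) x \<partial>M else 0) sums (\<Sum>\<^sub>\<infinity>k\<in>K. \<integral>x. f k x \<partial>M)"
    unfolding transfer by (rule has_sum_imp_sums)
  also have "(\<lambda>n. if n \<in> ?I then \<integral>x. f (?k n) x \<partial>M else 0) = (\<lambda>n. \<integral>x. F n x \<partial>M)"
    by (auto simp: F_def)
  finally have "(\<Sum>\<^sub>\<infinity>k\<in>K. \<integral>x. f k x \<partial>M) = (\<Sum>n. \<integral>x. F n x \<partial>M)"
    by (rule sums_unique)
  also have "\<dots> = (\<integral>x. (\<Sum>n. F n x) \<partial>M)"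
    by (rule integral_suminf[symmetric]) (use F_int F_norm F_norm_int in auto)
  finally show "(\<integral>x. (\<Sum>\<^sub>\<infinity>k\<in>K. f k x) \<partial>M) = (\<Sum>\<^sub>\<infinity>k\<in>K. \<integral>x. f k x \<partial>M)"
    by (simp add: F_suminf)
qed

text \<open>
  An absolutely summable family is the family of Fourier coefficients of its trigonometric series.
  This identifies the coefficients of the kernel sections and those of the extremal function for
  the worst-case error.
\<close>

lemma
  assumes sum: "(\<lambda>k. norm (a k)) summable_on freqs s"
  shows integrable_trig_series: "integrable (cube_measure s) (\<lambda>x. \<Sum>\<^sub>\<infinity>k\<in>freqs s. a k * trig s k x)"
    and fourier_coeff_trig_series:
      "l \<in> freqs s \<Longrightarrow> fourier_coeff s (\<lambda>x. \<Sum>\<^sub>\<infinity>k\<in>freqs s. a k * trig s k x) l = a l"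
proof -
  interpret prob_space "cube_measure s" by (rule prob_space_cube_measure)
  show "integrable (cube_measure s) (\<lambda>x. \<Sum>\<^sub>\<infinity>k\<in>freqs s. a k * trig s k x)"
    by (rule integrable_infsum_bounded[OF countable_freqs _ _ sum])
       (auto simp: norm_mult integrable_trig)
  assume l: "l \<in> freqs s"
  have "fourier_coeff s (\<lambda>x. \<Sum>\<^sub>\<infinity>k\<in>freqs s. a k * trig s k x) l =
      (\<integral>x. (\<Sum>\<^sub>\<infinity>k\<in>freqs s. a k * trig s k x * cnj (trig s l x)) \<partial>cube_measure s)"
    unfolding fourier_coeff_trig by (simp add: infsum_cmult_left')
  also have "\<dots> = (\<Sum>\<^sub>\<infinity>k\<in>freqs s. \<integral>x. a k * trig s k x * cnj (trig s l x) \<partial>cube_measure s)"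
    by (rule integral_infsum_bounded[OF countable_freqs _ _ sum])
       (auto simp: norm_mult mult.assoc trig_mult_cnj integrable_trig)
  also have "\<dots> = (\<Sum>\<^sub>\<infinity>k\<in>freqs s. a k * fourier_coeff s (trig s k) l)"
    by (simp add: fourier_coeff_trig mult.assoc)
  also have "\<dots> = (\<Sum>\<^sub>\<infinity>k\<in>{l}. a k)"
    by (rule infsum_cong_neutral) (use l in \<open>auto simp: fourier_coeff_trig_eq\<close>)
  finally show "fourier_coeff s (\<lambda>x. \<Sum>\<^sub>\<infinity>k\<in>freqs s. a k * trig s k x) l = a l" by simp
qed

text \<open>
  Taking fractional parts changes the phase by integer multiples of \<open>2 \<pi>\<close> only, so along the
  lattice a character is a geometric progression of \<open>N\<close>-th roots of unity.
\<close>

lemma sum_trig_lattice_point: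
  assumes N: "N > 0"
  shows "(\<Sum>n<N. trig s k (lattice_point s N g n)) =
    (if int N dvd (\<Sum>j=1..s. k j * int (g j)) then of_nat N else 0)"
proof -
  let ?a = "\<Sum>j=1..s. k j * int (g j)"
  let ?z = "cis (2 * pi * (real_of_int ?a / real N))"
  have trig: "trig s k (lattice_point s N g n) = ?z ^ n" for n
  proof -
    have "trig s k (lattice_point s N g n) =
        (\<Prod>j=1..s. cis (2 * pi * (real_of_int (k j) * (real n * real (g j) / real N))))"
      unfolding trig_prod
    proof (rule prod.cong[OF refl])
      fix j assume j: "j \<in> {1..s}"
      let ?t = "real n * real (g j) / real N"
      have "cis (2 * pi * real_of_int (k j) * frac ?t) =
          cis (2 * pi * (real_of_int (k j) * ?t) - 2 * pi * (real_of_int (k j * \<lfloor>?t\<rfloor>)))"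
        by (rule arg_cong[where f = cis]) (simp add: frac_def algebra_simps)
      also have "\<dots> = cis (2 * pi * (real_of_int (k j) * ?t)) / cis (2 * pi * (real_of_int (k j * \<lfloor>?t\<rfloor>)))"
        by (rule cis_divide[symmetric])
      also have "cis (2 * pi * (real_of_int (k j * \<lfloor>?t\<rfloor>))) = 1"
        by (rule cis_multiple_2pi) auto
      finally show "cis (2 * pi * real_of_int (k j) * lattice_point s N g n j) = cis (2 * pi * (real_of_int (k j) * ?t))"
        using j by (simp add: lattice_point_def)
    qed
    also have "\<dots> = cis (\<Sum>j=1..s. 2 * pi * (real_of_int (k j) * (real n * real (g j) / real N)))"
      by (simp add: cis_sum)
    also have "\<dots> = cis (real n * (2 * pi * (real_of_int ?a / real N)))"
      by (rule arg_cong[where f = cis])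
         (simp add: sum_distrib_left sum_divide_distrib mult_ac)
    finally show ?thesis by (simp only: Complex.DeMoivre)
  qed
  show ?thesis
  proof (cases "int N dvd ?a")
    case True
    then obtain m where "?a = int N * m" by (rule dvdE)
    hence "real_of_int ?a / real N = real_of_int m" using N by simp
    hence "?z = 1" by (simp only: cis_multiple_2pi Ints_of_int)
    thus ?thesis using True by (simp add: trig)
  next
    case False
    have "?z \<noteq> 1"
    proof
      assume "?z = 1"
      then obtain m where "2 * pi * (real_of_int ?a / real N) = of_int m * (2 * pi)"
        unfolding cis_eq_1_iff by blast
      hence "real_of_int ?a = real_of_int (m * int N)" using N by (simp add: field_simps)
      hence "?a = m * int N" by (simp only: of_int_eq_iff)
      thus False using False by simp
    qed
    moreover have "?z ^ N = 1"
    proof -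
      have "?z ^ N = cis (2 * pi * real_of_int ?a)" using N by (simp add: Complex.DeMoivre)
      also have "\<dots> = 1" by (rule cis_multiple_2pi) auto
      finally show ?thesis .
    qed
    ultimately show ?thesis using False by (simp add: trig sum_gp_strict)
  qed
qed

section \<open>The worst-case error as a sum over the dual lattice\<close>

definition dual_lattice :: "nat \<Rightarrow> nat \<Rightarrow> (nat \<Rightarrow> nat) \<Rightarrow> (nat \<Rightarrow> int) set" where
  "dual_lattice d N g = {k \<in> freqs d. int N dvd (\<Sum>j=1..d. k j * int (g j))}"

definition zero_freq :: "nat \<Rightarrow> nat \<Rightarrow> int" where
  "zero_freq d = (\<lambda>j\<in>{1..d}. 0)"

definition dual_sum :: "(nat \<Rightarrow> int \<Rightarrow> real) \<Rightarrow> nat \<Rightarrow> nat \<Rightarrow> (nat \<Rightarrow> nat) \<Rightarrow> real" where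
  "dual_sum \<rho> d N g = (\<Sum>\<^sub>\<infinity>k\<in>dual_lattice d N g - {zero_freq d}. prod_weight \<rho> d k)"

lemma zero_freq_in_dual_lattice: "zero_freq d \<in> dual_lattice d N g"
  by (simp add: zero_freq_def dual_lattice_def freqs_def)

text \<open>
  Cauchy--Schwarz in the weighted form that is needed, from the inequality between the arithmetic
  and the geometric mean with a free parameter \<open>t\<close>; the choice \<open>t = 1\<close> gives summability and
  the square root of the total weight gives the sharp constant.
\<close>

lemma
  fixes a :: "'i \<Rightarrow> complex"
  assumes pos: "\<And>k. k \<in> K \<Longrightarrow> r k > 0" and r: "r summable_on K"
    and a: "(\<lambda>k. (norm (a k))\<^sup>2 * inverse (r k)) summable_on K"
  shows summable_norm_weighted: "(\<lambda>k. norm (a k)) summable_on K"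
    and infsum_norm_weighted_le: "(\<Sum>\<^sub>\<infinity>k\<in>K. (norm (a k))\<^sup>2 * inverse (r k)) \<le> 1 \<Longrightarrow>
      (\<Sum>\<^sub>\<infinity>k\<in>K. norm (a k)) \<le> sqrt (infsum r K)"
proof -
  have amgm: "norm (a k) \<le> t / 2 * ((norm (a k))\<^sup>2 * inverse (r k)) + 1 / (2 * t) * r k"
    if "k \<in> K" "t > 0" for k and t :: real
  proof -
    have "0 \<le> (t * norm (a k) - r k)\<^sup>2 / (2 * t * r k)"
      using that pos[OF that(1)] by simp
    also have "\<dots> = t / 2 * ((norm (a k))\<^sup>2 * inverse (r k)) + 1 / (2 * t) * r k - norm (a k)"
      using that pos[OF that(1)] by (simp add: power2_diff field_simps power2_eq_square)
    finally show ?thesis by simp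
  qed
  have sum_t: "(\<lambda>k. t / 2 * ((norm (a k))\<^sup>2 * inverse (r k)) + 1 / (2 * t) * r k) summable_on K" for t :: real
    by (intro summable_on_add summable_on_cmult_right a r)
  show abs: "(\<lambda>k. norm (a k)) summable_on K"
    by (rule summable_on_comparison_test[OF sum_t[of 1]]) (use amgm[of _ 1] in auto)
  assume le1: "(\<Sum>\<^sub>\<infinity>k\<in>K. (norm (a k))\<^sup>2 * inverse (r k)) \<le> 1"
  show "(\<Sum>\<^sub>\<infinity>k\<in>K. norm (a k)) \<le> sqrt (infsum r K)"
  proof (cases "K = {}")
    case False
    then obtain k where k: "k \<in> K" by blast
    have "sum r {k} \<le> infsum r K"
      by (rule finite_sum_le_infsum) (use r k pos in \<open>auto intro: less_imp_le\<close>)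
    hence S: "infsum r K > 0" using pos[OF k] by simp
    let ?t = "sqrt (infsum r K)"
    have t: "?t > 0" using S by simp
    have "(\<Sum>\<^sub>\<infinity>k\<in>K. norm (a k)) \<le>
        (\<Sum>\<^sub>\<infinity>k\<in>K. ?t / 2 * ((norm (a k))\<^sup>2 * inverse (r k)) + 1 / (2 * ?t) * r k)"
      by (rule infsum_mono[OF abs sum_t]) (use amgm t in blast)
    also have "\<dots> = (\<Sum>\<^sub>\<infinity>k\<in>K. ?t / 2 * ((norm (a k))\<^sup>2 * inverse (r k))) + (\<Sum>\<^sub>\<infinity>k\<in>K. 1 / (2 * ?t) * r k)"
      by (intro infsum_add summable_on_cmult_right a r)
    also have "\<dots> = ?t / 2 * (\<Sum>\<^sub>\<infinity>k\<in>K. (norm (a k))\<^sup>2 * inverse (r k)) + 1 / (2 * ?t) * infsum r K"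
      by (simp only: infsum_cmult_right')
    also have "\<dots> \<le> ?t / 2 * 1 + 1 / (2 * ?t) * infsum r K"
      using le1 t by (intro add_right_mono mult_left_mono) auto
    also have "1 / (2 * ?t) * infsum r K = ?t / 2"
      using S by (simp add: field_simps)
    finally show ?thesis by simp
  qed simp
qed

lemma infsum_complex_of_real:
  "(\<Sum>\<^sub>\<infinity>k\<in>K. complex_of_real (f k)) = complex_of_real (infsum f K)"
proof (cases "f summable_on K")
  case True
  thus ?thesis by (intro infsumI has_sum_of_real has_sum_infsum)
next
  case False
  hence "\<not> (\<lambda>k. complex_of_real (f k)) summable_on K"
    using summable_on_Re[of "\<lambda>k. complex_of_real (f k)" K] by auto
  thus ?thesis using False by (simp add: infsum_not_exists)
qed

lemma lattice_point_in_unit_cube: "lattice_point s N g n \<in> unit_cube s"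
  by (auto simp: lattice_point_def unit_cube_def intro: less_imp_le[OF frac_lt_1])

lemma fourier_coeff_zero_freq: "fourier_coeff s f (zero_freq s) = (\<integral>x. f x \<partial>cube_measure s)"
  by (simp add: fourier_coeff_def zero_freq_def)

lemma korobov_r_eq_prod_weight:
  "korobov_r \<kappa> \<mu> \<gamma> s = prod_weight (\<lambda>j. korobov_r1 \<kappa> \<mu> (\<gamma> j)) s"
  by (simp add: fun_eq_iff korobov_r_def prod_weight_def)

text \<open>
  Positivity makes the inverse weights of the inner product meaningful, and summability makes the
  Fourier series of every function of the space converge absolutely.
\<close>

locale positive_summable_korobov =
  fixes \<kappa> \<mu> :: real and \<gamma> :: "nat \<Rightarrow> real" and s :: nat
  assumes korobov_r_pos: "\<And>k. k \<in> freqs s \<Longrightarrow> korobov_r \<kappa> \<mu> \<gamma> s k > 0"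
    and korobov_r_summable: "korobov_r \<kappa> \<mu> \<gamma> s summable_on freqs s"
begin

abbreviation "r \<equiv> korobov_r \<kappa> \<mu> \<gamma> s"

lemma fourier_coeff_kernel:
  assumes "k \<in> freqs s"
  shows "fourier_coeff s (\<lambda>y. log_korobov_kernel \<kappa> \<mu> \<gamma> s y x) k = of_real (r k) * cnj (trig s k x)"
proof -
  have "(\<lambda>y. log_korobov_kernel \<kappa> \<mu> \<gamma> s y x) =
      (\<lambda>y. \<Sum>\<^sub>\<infinity>k\<in>freqs s. (of_real (r k) * cnj (trig s k x)) * trig s k y)"
    unfolding log_korobov_kernel_def trig_minus_kernel by (simp add: mult_ac)
  moreover have "(\<lambda>k. norm (of_real (r k) * cnj (trig s k x))) summable_on freqs s"
    by (rule summable_on_cong[THEN iffD1, OF _ korobov_r_summable])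
       (use korobov_r_pos in \<open>auto simp: norm_mult abs_of_pos\<close>)
  ultimately show ?thesis using assms by (simp add: fourier_coeff_trig_series)
qed

text \<open>
  The reproducing property says that a function is the sum of its Fourier series on the cube,
  because the weight in the coefficients of the kernel section cancels the inverse weight in the
  inner product.
\<close>

lemma in_log_korobov_space_iff:
  "f \<in> log_korobov_space \<kappa> \<mu> \<gamma> s \<longleftrightarrow>
     integrable (cube_measure s) f \<and>
     (\<lambda>k. (cmod (fourier_coeff s f k))\<^sup>2 * inverse (r k)) summable_on freqs s \<and>
     (\<forall>x\<in>unit_cube s. f x = (\<Sum>\<^sub>\<infinity>k\<in>freqs s. fourier_coeff s f k * trig s k x))"
proof -
  have "log_korobov_inner \<kappa> \<mu> \<gamma> s f (\<lambda>y. log_korobov_kernel \<kappa> \<mu> \<gamma> s y x) =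
      (\<Sum>\<^sub>\<infinity>k\<in>freqs s. fourier_coeff s f k * trig s k x)" for x
    unfolding log_korobov_inner_def
  proof (rule infsum_cong)
    fix k assume k: "k \<in> freqs s"
    show "fourier_coeff s f k * cnj (fourier_coeff s (\<lambda>y. log_korobov_kernel \<kappa> \<mu> \<gamma> s y x) k) *
        of_real (inverse (r k)) = fourier_coeff s f k * trig s k x"
      using korobov_r_pos[OF k] by (simp add: fourier_coeff_kernel[OF k])
  qed
  thus ?thesis by (simp add: log_korobov_space_def)
qed

lemma log_korobov_norm_eq:
  "log_korobov_norm \<kappa> \<mu> \<gamma> s f =
     sqrt (\<Sum>\<^sub>\<infinity>k\<in>freqs s. (cmod (fourier_coeff s f k))\<^sup>2 * inverse (r k))"
proof -
  have "fourier_coeff s f k * cnj (fourier_coeff s f k) * of_real (inverse (r k)) =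
      of_real ((cmod (fourier_coeff s f k))\<^sup>2 * inverse (r k))" for k
    unfolding of_real_mult complex_norm_square ..
  hence "log_korobov_inner \<kappa> \<mu> \<gamma> s f f =
      of_real (\<Sum>\<^sub>\<infinity>k\<in>freqs s. (cmod (fourier_coeff s f k))\<^sup>2 * inverse (r k))"
    unfolding log_korobov_inner_def by (simp only: infsum_complex_of_real)
  thus ?thesis by (simp add: log_korobov_norm_def)
qed

lemma fourier_coeff_abs_summable:
  assumes "f \<in> log_korobov_space \<kappa> \<mu> \<gamma> s"
  shows "(\<lambda>k. norm (fourier_coeff s f k)) summable_on freqs s"
  using assms korobov_r_pos korobov_r_summable
  by (intro summable_norm_weighted[where r = r]) (auto simp: in_log_korobov_space_iff)

text \<open>
  The rule sees a character as the constant \<open>1\<close> on the dual lattice and as \<open>0\<close> off it, whereas the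
  integral retains the zero frequency only.
\<close>

lemma lattice_rule_error:
  assumes f: "f \<in> log_korobov_space \<kappa> \<mu> \<gamma> s" and N: "N > 0"
  shows "(\<integral>x. f x \<partial>cube_measure s) - (1 / of_nat N) * (\<Sum>n<N. f (lattice_point s N g n)) =
    - (\<Sum>\<^sub>\<infinity>k\<in>dual_lattice s N g - {zero_freq s}. fourier_coeff s f k)"
proof -
  let ?c = "fourier_coeff s f" and ?L = "dual_lattice s N g" and ?p = "lattice_point s N g"
  have abs: "(\<lambda>k. norm (?c k)) summable_on freqs s" by (rule fourier_coeff_abs_summable[OF f])
  have sub: "?L \<subseteq> freqs s" by (auto simp: dual_lattice_def)
  have c_sum: "?c summable_on ?L"
    by (rule summable_on_subset[OF abs_summable_summable[OF abs] sub])
  have "(\<lambda>k. norm (?c k * trig s k x)) summable_on freqs s" for x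
    using abs by (simp add: norm_mult)
  hence sum: "(\<lambda>k. ?c k * trig s k x) summable_on freqs s" for x
    by (rule abs_summable_summable)
  have "(\<Sum>n<N. f (?p n)) = (\<Sum>n<N. \<Sum>\<^sub>\<infinity>k\<in>freqs s. ?c k * trig s k (?p n))"
    using f lattice_point_in_unit_cube by (simp add: in_log_korobov_space_iff)
  also have "\<dots> = (\<Sum>\<^sub>\<infinity>k\<in>freqs s. \<Sum>n<N. ?c k * trig s k (?p n))"
    by (rule infsumI[OF has_sum_finite_sum, symmetric]) (use sum in auto)
  also have "\<dots> = (\<Sum>\<^sub>\<infinity>k\<in>freqs s. ?c k * (\<Sum>n<N. trig s k (?p n)))"
    by (simp add: sum_distrib_left)
  also have "\<dots> = (\<Sum>\<^sub>\<infinity>k\<in>?L. ?c k * of_nat N)"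
    by (rule infsum_cong_neutral) (use N in \<open>auto simp: sum_trig_lattice_point dual_lattice_def\<close>)
  also have "\<dots> = (\<Sum>\<^sub>\<infinity>k\<in>?L. ?c k) * of_nat N" by (rule infsum_cmult_left')
  finally have "(1 / of_nat N) * (\<Sum>n<N. f (?p n)) = (\<Sum>\<^sub>\<infinity>k\<in>?L. ?c k)"
    using N by simp
  also have "?L = insert (zero_freq s) (?L - {zero_freq s})"
    using zero_freq_in_dual_lattice by blast
  also have "infsum ?c \<dots> = ?c (zero_freq s) + infsum ?c (?L - {zero_freq s})"
    by (rule infsum_insert) (use summable_on_subset[OF c_sum] in auto)
  finally show ?thesis by (simp add: fourier_coeff_zero_freq)
qed

text \<open>
  Equality, rather than an upper bound, is essential: the algorithm minimizes the worst-case error,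
  and only an exact formula turns this into minimality of the increment of the dual sum.
\<close>

lemma lattice_error_sq_eq_dual_sum:
  assumes N: "N > 0"
  shows "(lattice_error \<kappa> \<mu> \<gamma> s N g)\<^sup>2 = dual_sum (\<lambda>j. korobov_r1 \<kappa> \<mu> (\<gamma> j)) s N g"
proof -
  let ?D = "dual_lattice s N g - {zero_freq s}"
  let ?H = "{f \<in> log_korobov_space \<kappa> \<mu> \<gamma> s. log_korobov_norm \<kappa> \<mu> \<gamma> s f \<le> 1}"
  let ?err = "\<lambda>f. cmod ((\<integral>x. f x \<partial>cube_measure s) - (1 / of_nat N) * (\<Sum>n<N. f (lattice_point s N g n)))"
  define S where "S = infsum r ?D"
  have sub: "?D \<subseteq> freqs s" by (auto simp: dual_lattice_def)
  have rD: "r summable_on ?D" by (rule summable_on_subset[OF korobov_r_summable sub])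
  have S_nonneg: "S \<ge> 0"
    unfolding S_def by (rule infsum_nonneg) (use sub korobov_r_pos in \<open>auto intro!: less_imp_le\<close>)
  have upper: "?err f \<le> sqrt S" if f: "f \<in> ?H" for f
  proof -
    let ?c = "fourier_coeff s f"
    let ?q = "\<lambda>k. (cmod (?c k))\<^sup>2 * inverse (r k)"
    have q: "?q summable_on freqs s" using f by (simp add: in_log_korobov_space_iff)
    have q_nonneg: "?q k \<ge> 0" if "k \<in> freqs s" for k using korobov_r_pos[OF that] by simp
    have qD: "?q summable_on ?D" by (rule summable_on_subset[OF q sub])
    have "infsum ?q ?D \<le> infsum ?q (freqs s)"
      by (rule infsum_mono2[OF qD q sub]) (use q_nonneg in auto)
    also have "\<dots> \<le> 1" using f by (simp add: log_korobov_norm_eq)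
    finally have "(\<Sum>\<^sub>\<infinity>k\<in>?D. cmod (?c k)) \<le> sqrt S"
      unfolding S_def using infsum_norm_weighted_le[OF _ rD qD] sub korobov_r_pos by blast
    moreover have "cmod (infsum ?c ?D) \<le> (\<Sum>\<^sub>\<infinity>k\<in>?D. cmod (?c k))"
      by (rule norm_infsum_bound)
         (use f sub fourier_coeff_abs_summable[of f] in \<open>auto intro: summable_on_subset\<close>)
    ultimately show ?thesis using lattice_rule_error[OF _ N] f by (simp only: norm_minus_cancel mem_Collect_eq) 
  qed
  have "\<exists>f\<in>?H. ?err f = sqrt S"
  proof -
    \<comment> \<open>the case of equality in Cauchy--Schwarz, normalized; for \<open>S = 0\<close> it is the zero function\<close>
    define a where "a k = (if k \<in> ?D then complex_of_real (r k / sqrt S) else 0)" for k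
    define f where "f x = (\<Sum>\<^sub>\<infinity>k\<in>freqs s. a k * trig s k x)" for x
    have a_sum: "(\<lambda>k. norm (a k)) summable_on freqs s"
    proof (rule summable_on_comparison_test[OF summable_on_cmult_left[OF korobov_r_summable]])
      show "norm (a k) \<le> r k * (1 / sqrt S)" if "k \<in> freqs s" for k
        using korobov_r_pos[OF that] S_nonneg by (auto simp: a_def norm_divide)
    qed auto
    have coeff: "fourier_coeff s f k = a k" if "k \<in> freqs s" for k
      unfolding f_def[abs_def] by (rule fourier_coeff_trig_series[OF a_sum that])
    \<comment> \<open>the value \<open>S / S\<close> is \<open>1\<close> or, for \<open>S = 0\<close>, zero; in both cases the norm is at most \<open>1\<close>\<close>
    have q: "((\<lambda>k. (cmod (fourier_coeff s f k))\<^sup>2 * inverse (r k)) has_sum S / S) (freqs s)"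
    proof -
      have "((\<lambda>k. r k / S) has_sum S / S) ?D"
        unfolding S_def by (rule has_sum_divide_const[OF has_sum_infsum[OF rD]])
      also have "?this \<longleftrightarrow> ?thesis"
        using sub korobov_r_pos S_nonneg
        by (intro has_sum_cong_neutral)
           (auto simp: coeff a_def norm_divide power_divide field_simps power2_eq_square subset_iff less_imp_le)
      finally show ?thesis .
    qed
    have f: "f \<in> log_korobov_space \<kappa> \<mu> \<gamma> s"
      unfolding in_log_korobov_space_iff
    proof (intro conjI ballI)
      show "integrable (cube_measure s) f"
        unfolding f_def[abs_def] by (rule integrable_trig_series[OF a_sum])
      show "f x = (\<Sum>\<^sub>\<infinity>k\<in>freqs s. fourier_coeff s f k * trig s k x)" for x
        unfolding f_def[of x] by (rule infsum_cong) (simp add: coeff)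
    qed (use q has_sum_imp_summable in blast)
    have "log_korobov_norm \<kappa> \<mu> \<gamma> s f \<le> 1"
      using infsumI[OF q] by (simp add: log_korobov_norm_eq)
    moreover have "?err f = sqrt S"
    proof -
      have "infsum (fourier_coeff s f) ?D = (\<Sum>\<^sub>\<infinity>k\<in>?D. complex_of_real (r k / sqrt S))"
        by (rule infsum_cong) (use sub coeff in \<open>auto simp: a_def\<close>)
      also have "\<dots> = of_real (S / sqrt S)"
        unfolding S_def by (simp only: infsum_complex_of_real infsumI[OF has_sum_divide_const[OF has_sum_infsum[OF rD]]])
      also have "S / sqrt S = sqrt S" using S_nonneg by (rule real_div_sqrt)
      finally show ?thesis using S_nonneg
        by (simp only: lattice_rule_error[OF f N] norm_minus_cancel norm_of_real) simp
    qed
    ultimately show ?thesis using f by blast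
  qed
  then obtain f where f: "f \<in> ?H" "?err f = sqrt S" by blast
  have "lattice_error \<kappa> \<mu> \<gamma> s N g = Sup (?err ` ?H)"
    by (simp add: lattice_error_def worst_case_error_def)
  also have "\<dots> = sqrt S"
    by (rule cSup_eq_maximum) (use f upper in \<open>auto intro!: image_eqI[of _ _ f]\<close>)
  finally show ?thesis
    using S_nonneg by (simp add: S_def dual_sum_def korobov_r_eq_prod_weight)
qed

end

section \<open>Adding a component to the generating vector\<close>

definition new_freqs :: "nat \<Rightarrow> nat \<Rightarrow> (nat \<Rightarrow> nat) \<Rightarrow> nat \<Rightarrow> (nat \<Rightarrow> int) set" where
  "new_freqs d N g h = {k \<in> freqs (Suc d). k (Suc d) \<noteq> 0 \<and>
     int N dvd (\<Sum>j=1..d. k j * int (g j)) + k (Suc d) * int h}"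

definition new_sum :: "(nat \<Rightarrow> int \<Rightarrow> real) \<Rightarrow> nat \<Rightarrow> nat \<Rightarrow> (nat \<Rightarrow> nat) \<Rightarrow> nat \<Rightarrow> real" where
  "new_sum \<rho> d N g h = (\<Sum>\<^sub>\<infinity>k\<in>new_freqs d N g h. prod_weight \<rho> (Suc d) k)"

lemma dual_sum_upd [simp]: "dual_sum \<rho> d N (g(Suc d := h)) = dual_sum \<rho> d N g"
  by (simp add: dual_sum_def dual_lattice_def)

lemma new_sum_upd [simp]: "new_sum \<rho> d N (g(Suc d := h)) h' = new_sum \<rho> d N g h'"
  by (simp add: new_sum_def new_freqs_def)

lemma dual_sum_0 [simp]: "dual_sum \<rho> 0 N g = 0"
proof -
  have "dual_lattice 0 N g - {zero_freq 0} = {}"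
    by (auto simp: dual_lattice_def freqs_def zero_freq_def)
  thus ?thesis unfolding dual_sum_def by (simp only: infsum_empty)
qed

text \<open>
  The dual frequencies with last component zero are those of the shorter vector, so they
  contribute the old sum; the increment is the only part that depends on the new component.
\<close>

lemma dual_sum_Suc:
  assumes sum: "prod_weight \<rho> (Suc d) summable_on freqs (Suc d)" and \<rho>0: "\<rho> (Suc d) 0 = 1"
  shows "dual_sum \<rho> (Suc d) N g = dual_sum \<rho> d N g + new_sum \<rho> d N g (g (Suc d))"
proof -
  let ?A = "dual_lattice d N g - {zero_freq d}" and ?B = "new_freqs d N g (g (Suc d))"
  let ?e = "\<lambda>k::nat \<Rightarrow> int. k(Suc d := 0)"
  have ext: "k (Suc d) = undefined" if "k \<in> freqs d" for k
    using that by (auto simp: freqs_def PiE_def extensional_def)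
  have inj: "inj_on ?e (freqs d)"
    by (rule inj_onI) (metis ext fun_upd_triv fun_upd_upd)
  have range: "k \<in> freqs (Suc d) \<and> k (Suc d) = 0 \<longleftrightarrow> k \<in> ?e ` freqs d" for k
  proof
    assume k: "k \<in> freqs (Suc d) \<and> k (Suc d) = 0"
    then obtain k' m where "k' \<in> freqs d" "k = k'(Suc d := m)"
      using bij_betw_imp_surj_on[OF bij_betw_freqs_Suc[of d]] by force
    thus "k \<in> ?e ` freqs d" using k by auto
  qed (use bij_betw_imp_surj_on[OF bij_betw_freqs_Suc[of d]] in force)
  have zero: "zero_freq (Suc d) = ?e (zero_freq d)"
    by (auto simp: zero_freq_def fun_eq_iff restrict_def)
  have split: "dual_lattice (Suc d) N g - {zero_freq (Suc d)} = ?e ` ?A \<union> ?B" (is "?L = _")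
  proof (intro set_eqI)
    fix k
    show "k \<in> ?L \<longleftrightarrow> k \<in> ?e ` ?A \<union> ?B"
    proof (cases "k (Suc d) = 0")
      case True
      hence "k \<notin> ?B" by (simp add: new_freqs_def)
      moreover have "k \<in> ?L \<longleftrightarrow> k \<in> ?e ` ?A"
      proof (cases "k \<in> ?e ` freqs d")
        case True
        then obtain k' where k': "k' \<in> freqs d" "k = ?e k'" by auto
        have "zero_freq d \<in> freqs d" by (simp add: zero_freq_def freqs_def)
        hence "k = zero_freq (Suc d) \<longleftrightarrow> k' = zero_freq d"
          unfolding zero using k' inj by (auto simp: inj_on_def)
        moreover have "k \<in> dual_lattice (Suc d) N g \<longleftrightarrow> k' \<in> dual_lattice d N g"
          using k' range[of k] by (auto simp: dual_lattice_def)
        moreover have "k \<in> ?e ` ?A \<longleftrightarrow> k' \<in> ?A"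
          using k' inj by (auto simp: inj_on_def dual_lattice_def)
        ultimately show ?thesis by auto
      next
        case False
        thus ?thesis using \<open>k (Suc d) = 0\<close> range[of k] by (auto simp: dual_lattice_def)
      qed
      ultimately show ?thesis by blast
    next
      case False
      hence "k \<noteq> zero_freq (Suc d)" unfolding zero by auto
      thus ?thesis using False by (auto simp: dual_lattice_def new_freqs_def)
    qed
  qed
  have sub: "?e ` ?A \<subseteq> freqs (Suc d)" "?B \<subseteq> freqs (Suc d)"
    using range by (auto simp: dual_lattice_def new_freqs_def)
  have "dual_sum \<rho> (Suc d) N g =
      infsum (prod_weight \<rho> (Suc d)) (?e ` ?A) + infsum (prod_weight \<rho> (Suc d)) ?B"
    unfolding dual_sum_def split
    by (rule infsum_Un_disjoint) (use sub sum in \<open>auto intro: summable_on_subset simp: new_freqs_def\<close>)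
  also have "infsum (prod_weight \<rho> (Suc d)) (?e ` ?A) = infsum (prod_weight \<rho> d) ?A"
    by (subst infsum_reindex)
       (use inj in \<open>auto intro: inj_on_subset simp: dual_lattice_def prod_weight_Suc \<rho>0 o_def\<close>)
  finally show ?thesis by (simp add: dual_sum_def new_sum_def)
qed

lemma card_dvd_linear_le:
  assumes N: "prime N" "\<not> int N dvd m"
  shows "card {h \<in> {1..N - 1}. int N dvd a + m * int h} \<le> 1"
proof -
  have "h = h'" if "h \<in> {1..N - 1}" "h' \<in> {1..N - 1}" "int N dvd a + m * int h" "int N dvd a + m * int h'" for h h'
  proof -
    have "int N dvd m * (int h - int h')"
      using dvd_diff[OF that(3,4)] by (simp add: algebra_simps)
    hence "int N dvd int h - int h'" using N prime_dvd_mult_iff[of "int N"] by auto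
    moreover have "\<bar>int h - int h'\<bar> < int N" using that(1,2) N(1) by auto
    ultimately have "int h - int h' = 0" using dvd_imp_le_int[of "int h - int h'" "int N"] by linarith
    thus ?thesis by simp
  qed
  thus ?thesis unfolding One_nat_def by (subst card_le_Suc0_iff_eq) auto
qed

text \<open>
  Exchanging the sum over the candidates \<open>h\<close> with the sum over the frequencies leaves, for each
  frequency, the number of candidates for which it is dual.  That number is at most \<open>1\<close> if \<open>N\<close>
  does not divide the last component and at most \<open>N - 1\<close> otherwise.  The latter frequencies have
  total mass at most \<open>1 / N\<close> times that of all frequencies by the decay hypothesis, so each
  kind contributes at most the total mass, whence the factor \<open>2\<close>.
\<close>

lemma sum_new_sum_le:
  fixes \<rho> :: "nat \<Rightarrow> int \<Rightarrow> real"
  assumes N: "prime N"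
    and sums: "\<And>j. j \<in> {1..Suc d} \<Longrightarrow> (\<rho> j has_sum (1 + \<sigma> j)) UNIV"
    and nonneg: "\<And>j m. j \<in> {1..Suc d} \<Longrightarrow> \<rho> j m \<ge> 0"
    and \<rho>0: "\<And>j. j \<in> {1..Suc d} \<Longrightarrow> \<rho> j 0 = 1"
    and decay: "\<And>m. m \<noteq> 0 \<Longrightarrow> \<rho> (Suc d) (int N * m) \<le> \<rho> (Suc d) m / real N"
  shows "(\<Sum>h=1..N - 1. new_sum \<rho> d N g h) \<le> 2 * \<sigma> (Suc d) * (\<Prod>j=1..d. 1 + \<sigma> j)"
proof -
  let ?W = "prod_weight \<rho> (Suc d)" and ?r = "\<rho> (Suc d)"
  let ?f = "\<lambda>h k. if k \<in> new_freqs d N g h then ?W k else 0"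
  \<comment> \<open>the last weight times the bound on the number of candidates: the upper bound is again a product weight\<close>
  define \<tau> where "\<tau> m = (if m = 0 then 0 else ?r m * (1 + (if int N dvd m then real (N - 1) else 0)))" for m
  define \<rho>' where "\<rho>' = \<rho>(Suc d := \<tau>)"
  have N0: "N > 0" using N prime_gt_0_nat by blast
  have W_sum: "?W summable_on freqs (Suc d)"
    by (rule has_sum_imp_summable[OF has_sum_prod_weight[OF sums nonneg]])
  have W_nonneg: "?W k \<ge> 0" for k using nonneg by (intro prod_weight_nonneg) auto
  have f_sum: "?f h summable_on freqs (Suc d)" for h
    by (rule summable_on_comparison_test[OF W_sum]) (use W_nonneg in auto)
  have new_sum_eq: "new_sum \<rho> d N g h = infsum (?f h) (freqs (Suc d))" for h
    unfolding new_sum_def by (rule infsum_cong_neutral) (auto simp: new_freqs_def)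
  have lhs: "((\<lambda>k. \<Sum>h=1..N-1. ?f h k) has_sum (\<Sum>h=1..N-1. new_sum \<rho> d N g h)) (freqs (Suc d))"
    unfolding new_sum_eq by (rule has_sum_finite_sum) (use f_sum in auto)
  have r0: "(?r has_sum \<sigma> (Suc d)) (UNIV - {0})"
  proof -
    have "(?r has_sum (1 + \<sigma> (Suc d) - 1)) (UNIV - {0})"
      by (rule has_sum_Diff) (use sums \<rho>0 in \<open>auto simp: has_sum_finite_iff\<close>)
    thus ?thesis by simp
  qed
  have nonzero_mult: "(\<lambda>m. int N * m) ` (UNIV - {0}) = {m. m \<noteq> 0 \<and> int N dvd m}"
    using N0 by (auto simp: image_iff elim: dvdE)
  have mult_sum: "?r summable_on {m. m \<noteq> 0 \<and> int N dvd m}"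
    by (rule summable_on_subset[OF has_sum_imp_summable[OF r0]]) auto
  have mult_le: "infsum ?r {m. m \<noteq> 0 \<and> int N dvd m} \<le> \<sigma> (Suc d) / real N"
  proof -
    have inj: "inj_on (\<lambda>m. int N * m) (UNIV - {0})" using N0 by (auto simp: inj_on_def)
    have "infsum ?r {m. m \<noteq> 0 \<and> int N dvd m} = infsum (\<lambda>m. ?r (int N * m)) (UNIV - {0})"
      unfolding nonzero_mult[symmetric] by (subst infsum_reindex[OF inj]) (simp add: o_def)
    also have "\<dots> \<le> infsum (\<lambda>m. ?r m / real N) (UNIV - {0})"
    proof (rule infsum_mono)
      show "(\<lambda>m. ?r (int N * m)) summable_on UNIV - {0}"
        using mult_sum unfolding nonzero_mult[symmetric] by (subst (asm) summable_on_reindex[OF inj]) (simp add: o_def)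
      show "(\<lambda>m. ?r m / real N) summable_on UNIV - {0}"
        using has_sum_divide_const[OF r0] has_sum_imp_summable by blast
    qed (use decay in auto)
    also have "\<dots> = \<sigma> (Suc d) / real N" using has_sum_divide_const[OF r0] by (rule infsumI)
    finally show ?thesis .
  qed
  have \<tau>_sum: "(\<tau> has_sum (\<sigma> (Suc d) + real (N - 1) * infsum ?r {m. m \<noteq> 0 \<and> int N dvd m})) UNIV"
  proof -
    have 1: "((\<lambda>m. if m = 0 then 0 else ?r m) has_sum \<sigma> (Suc d)) UNIV"
      using r0 by (subst has_sum_cong_neutral[where T = "UNIV - {0}" and g = ?r]) auto
    have 2: "((\<lambda>m. if m \<noteq> 0 \<and> int N dvd m then real (N-1) * ?r m else 0) has_sum
        real (N-1) * infsum ?r {m. m \<noteq> 0 \<and> int N dvd m}) UNIV"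
      using has_sum_cmult_right[OF has_sum_infsum[OF mult_sum], of "real (N-1)"]
      by (subst has_sum_cong_neutral[where T = "{m. m \<noteq> 0 \<and> int N dvd m}" and g = "\<lambda>m. real (N-1) * ?r m"]) auto
    show ?thesis
      using has_sum_add[OF 1 2] by (rule has_sum_cong[THEN iffD1, rotated]) (auto simp: \<tau>_def algebra_simps)
  qed
  have \<tau>_nonneg: "\<tau> m \<ge> 0" for m using nonneg[of "Suc d" m] by (simp add: \<tau>_def)
  have rhs: "(prod_weight \<rho>' (Suc d) has_sum (\<Prod>j=1..d. 1 + \<sigma> j) *
      (\<sigma> (Suc d) + real (N - 1) * infsum ?r {m. m \<noteq> 0 \<and> int N dvd m})) (freqs (Suc d))"
  proof -
    let ?S = "(\<lambda>j. 1 + \<sigma> j)(Suc d := \<sigma> (Suc d) + real (N - 1) * infsum ?r {m. m \<noteq> 0 \<and> int N dvd m})"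
    have "(prod_weight \<rho>' (Suc d) has_sum (\<Prod>j=1..Suc d. ?S j)) (freqs (Suc d))"
      by (rule has_sum_prod_weight)
         (use \<tau>_sum \<tau>_nonneg sums nonneg in \<open>auto simp: \<rho>'_def le_Suc_eq\<close>)
    thus ?thesis by simp
  qed
  have "(\<Sum>h=1..N-1. ?f h k) \<le> prod_weight \<rho>' (Suc d) k" if "k \<in> freqs (Suc d)" for k
  proof (cases "k (Suc d) = 0")
    case True
    thus ?thesis using that by (simp add: new_freqs_def prod_weight_Suc \<rho>'_def \<tau>_def)
  next
    case False
    let ?H = "{h \<in> {1..N - 1}. int N dvd (\<Sum>j=1..d. k j * int (g j)) + k (Suc d) * int h}"
    have "(\<Sum>h=1..N-1. ?f h k) = (\<Sum>h\<in>?H. ?W k)"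
      using that False by (intro sum.mono_neutral_cong_right) (auto simp: new_freqs_def)
    also have "\<dots> = ?W k * real (card ?H)" by simp
    also have "\<dots> \<le> ?W k * (1 + (if int N dvd k (Suc d) then real (N - 1) else 0))"
    proof (intro mult_left_mono W_nonneg)
      have "card ?H \<le> card {1..N-1}" by (intro card_mono) auto
      thus "real (card ?H) \<le> 1 + (if int N dvd k (Suc d) then real (N - 1) else 0)"
        using card_dvd_linear_le[OF N, of "k (Suc d)" "\<Sum>j=1..d. k j * int (g j)"] by auto
    qed
    also have "\<dots> = prod_weight \<rho>' (Suc d) k"
      using False by (simp add: prod_weight_Suc \<rho>'_def \<tau>_def) (simp add: prod_weight_def)
    finally show ?thesis .
  qed
  hence "(\<Sum>h=1..N-1. new_sum \<rho> d N g h) \<le> (\<Prod>j=1..d. 1 + \<sigma> j) *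
      (\<sigma> (Suc d) + real (N - 1) * infsum ?r {m. m \<noteq> 0 \<and> int N dvd m})"
    using has_sum_mono[OF lhs rhs] by blast
  also have "\<dots> \<le> (\<Prod>j=1..d. 1 + \<sigma> j) * (\<sigma> (Suc d) + \<sigma> (Suc d))"
  proof (intro mult_left_mono add_left_mono prod_nonneg)
    have s0: "\<sigma> (Suc d) \<ge> 0" using has_sum_nonneg[OF r0] nonneg by auto
    have "real (N - 1) * infsum ?r {m. m \<noteq> 0 \<and> int N dvd m} \<le> real (N - 1) * (\<sigma> (Suc d) / real N)"
      by (intro mult_left_mono mult_le) auto
    also have "\<dots> \<le> \<sigma> (Suc d)"
      using N0 s0 by (simp add: divide_le_eq algebra_simps of_nat_diff)
    finally show "real (N - 1) * infsum ?r {m. m \<noteq> 0 \<and> int N dvd m} \<le> \<sigma> (Suc d)" .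
    show "0 \<le> 1 + \<sigma> j" if "j \<in> {1..d}" for j
      using that nonneg by (intro has_sum_nonneg[OF sums]) auto
  qed
  finally show ?thesis by (simp add: algebra_simps)
qed

text \<open>
  In dimension one every candidate generates the same lattice, so the prescribed first component
  \<open>1\<close> is also a minimizer of its increment.
\<close>

lemma new_sum_first_component:
  assumes "prime N" "h \<in> {1..N - 1}" "h' \<in> {1..N - 1}"
  shows "new_sum \<rho> 0 N g h = new_sum \<rho> 0 N g h'"
proof -
  have "int N dvd m * int h \<longleftrightarrow> int N dvd m" if "h \<in> {1..N - 1}" for m h
  proof -
    have "\<not> int N dvd int h" using that by (auto dest!: dvd_imp_le)
    thus ?thesis using assms(1) prime_dvd_mult_iff[of "int N"] by auto
  qed
  hence "new_freqs 0 N g h = new_freqs 0 N g h'"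
    using assms by (simp add: new_freqs_def)
  thus ?thesis by (simp add: new_sum_def)
qed

section \<open>The logarithmic factor and greedy selection\<close>

text \<open>
  The quotient \<open>\<phi>(x) / x\<close> for the comparison function \<open>\<phi>(x) = x max(M, - ln x)^A\<close>.  The cutoff \<open>M\<close>
  makes one formula work for all \<open>x > 0\<close>: \<open>M \<ge> 2\<close> yields submultiplicativity and \<open>M \<ge> A\<close>
  monotonicity of \<open>\<phi>\<close>.
\<close>

definition log_factor :: "real \<Rightarrow> real \<Rightarrow> real \<Rightarrow> real" where
  "log_factor M A x = max M (- ln x) powr A"

context
  fixes M A :: real
  assumes M: "M \<ge> 2" and A: "0 \<le> A" "A \<le> M"
begin

lemma log_factor_ge_1: "log_factor M A x \<ge> 1"
  unfolding log_factor_def using M A by (intro ge_one_powr_ge_zero) auto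

lemma log_factor_antimono:
  assumes "0 < x" "x \<le> y"
  shows "log_factor M A y \<le> log_factor M A x"
proof -
  have "ln x \<le> ln y" using assms by simp
  thus ?thesis unfolding log_factor_def using M A by (intro powr_mono2) linarith+
qed

text \<open>
  The logarithm turns the product into a sum, and a sum of two numbers that are at least \<open>2\<close> is at
  most their product.
\<close>

lemma log_factor_mult_le:
  assumes "x > 0" "y > 0"
  shows "log_factor M A (x * y) \<le> log_factor M A x * log_factor M A y"
proof -
  let ?a = "max M (- ln x)" and ?b = "max M (- ln y)"
  have "M \<le> ?a" "M \<le> ?b" "- ln x \<le> ?a" "- ln y \<le> ?b" by simp_all
  hence "max M (- ln (x * y)) \<le> ?a + ?b"
    unfolding ln_mult_pos[OF assms] using M by (intro max.boundedI) linarith+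
  also have "\<dots> \<le> ?a * ?b"
  proof -
    have "0 \<le> (?a - 2) * (?b - 1) + (?b - 2)" using M by (intro add_nonneg_nonneg mult_nonneg_nonneg) auto
    thus ?thesis by (simp add: algebra_simps)
  qed
  finally have "max M (- ln (x * y)) powr A \<le> (?a * ?b) powr A"
    using M A by (intro powr_mono2) auto
  also have "\<dots> = ?a powr A * ?b powr A" by (rule powr_mult)
  finally show ?thesis by (simp add: log_factor_def)
qed

lemma log_factor_prod_le:
  assumes "finite J" "J \<noteq> {}" "\<And>j. j \<in> J \<Longrightarrow> x j > 0"
  shows "log_factor M A (\<Prod>j\<in>J. x j) \<le> (\<Prod>j\<in>J. log_factor M A (x j))"
  using assms
proof (induction J rule: finite_ne_induct)
  case (insert i J)
  have "log_factor M A (\<Prod>j\<in>insert i J. x j) \<le> log_factor M A (x i) * log_factor M A (\<Prod>j\<in>J. x j)"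
    using insert by (simp add: log_factor_mult_le prod_pos)
  also have "\<dots> \<le> log_factor M A (x i) * (\<Prod>j\<in>J. log_factor M A (x j))"
    using insert log_factor_ge_1[of "x i"] by (intro mult_left_mono) auto
  finally show ?case using insert by simp
qed simp

text \<open>
  With \<open>b\<close> and \<open>c\<close> the truncated logarithms at \<open>x\<close> and \<open>y\<close>, the inequality \<open>ln (b / c) \<le> b / c - 1\<close>
  and \<open>A \<le> M \<le> c\<close> give \<open>A ln (b / c) \<le> b - c \<le> ln y - ln x\<close>.
\<close>

lemma mult_log_factor_mono:
  assumes "0 \<le> x" "x \<le> y"
  shows "x * log_factor M A x \<le> y * log_factor M A y"
proof (cases "x = 0")
  case True
  thus ?thesis using assms log_factor_ge_1[of y] by simp
next
  case False
  hence x: "x > 0" and y: "y > 0" using assms by auto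
  define b c where "b = max M (- ln x)" and "c = max M (- ln y)"
  have ln_le: "ln x \<le> ln y" using x y assms by simp
  have bc: "c \<ge> M" "b \<ge> c" "c > 0" "b - c \<le> ln y - ln x"
    using ln_le M by (auto simp: b_def c_def)
  have "A * (ln b - ln c) = A * ln (b / c)" using bc by (simp add: ln_div)
  also have "\<dots> \<le> A * (b / c - 1)" using A bc by (intro mult_left_mono ln_le_minus_one) auto
  also have "\<dots> = A * (b - c) / c" using bc by (simp add: field_simps)
  also have "\<dots> \<le> c * (b - c) / c" using A bc by (intro divide_right_mono mult_right_mono) auto
  also have "\<dots> \<le> ln y - ln x" using bc by simp
  finally have "exp (ln x + A * ln b) \<le> exp (ln y + A * ln c)" by (simp add: algebra_simps)
  thus ?thesis
    using x y bc by (simp add: exp_add log_factor_def b_def[symmetric] c_def[symmetric] powr_def)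
qed

text \<open>
  Countable subadditivity of \<open>\<phi>\<close>: as the factor is decreasing, its value at the total is at most
  its value at each term.
\<close>

lemma mult_log_factor_infsum_le:
  assumes r: "r summable_on K" and pos: "\<And>k. k \<in> K \<Longrightarrow> r k > 0"
    and w: "w summable_on K" and le: "\<And>k. k \<in> K \<Longrightarrow> r k * log_factor M A (r k) \<le> w k"
  shows "infsum r K * log_factor M A (infsum r K) \<le> infsum w K"
proof -
  have "infsum r K * log_factor M A (infsum r K) = (\<Sum>\<^sub>\<infinity>k\<in>K. r k * log_factor M A (infsum r K))"
    by (rule infsum_cmult_left'[symmetric])
  also have "\<dots> \<le> infsum w K"
  proof (rule infsum_mono[OF summable_on_cmult_left[OF r] w])
    fix k assume k: "k \<in> K"
    have "sum r {k} \<le> infsum r K"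
      by (rule finite_sum_le_infsum) (use r k pos in \<open>auto intro: less_imp_le\<close>)
    hence "log_factor M A (infsum r K) \<le> log_factor M A (r k)"
      using pos[OF k] by (intro log_factor_antimono) auto
    hence "r k * log_factor M A (infsum r K) \<le> r k * log_factor M A (r k)"
      using pos[OF k] by (intro mult_left_mono) auto
    thus "r k * log_factor M A (infsum r K) \<le> w k" using le[OF k] by linarith
  qed
  finally show ?thesis .
qed

lemma mult_log_factor_add_le:
  assumes "x \<ge> 0" "y \<ge> 0"
  shows "(x + y) * log_factor M A (x + y) \<le> x * log_factor M A x + y * log_factor M A y"
proof (cases "x = 0 \<or> y = 0")
  case False
  hence "log_factor M A (x + y) \<le> log_factor M A x" "log_factor M A (x + y) \<le> log_factor M A y"
    using assms by (auto intro!: log_factor_antimono)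
  thus ?thesis using assms by (simp add: distrib_right add_mono mult_left_mono)
qed auto

text \<open>
  Since \<open>\<phi>(x) \<ge> x\<close>, the hypothesis gives \<open>x \<le> B / N\<close> first.  Hence \<open>ln N \<le> - ln x + ln B\<close>, so the
  factor is at least a multiple of \<open>ln(N)^A\<close>.
\<close>

lemma le_of_mult_log_factor_le:
  assumes x: "x \<ge> 0" and B: "B \<ge> 1" and N: "N > 1" and le: "x * log_factor M A x \<le> B / N"
  shows "x \<le> B * (1 + ln B) powr A / (N * ln N powr A)"
proof (cases "x = 0")
  case True
  thus ?thesis using B N by simp
next
  case False
  hence x: "x > 0" using assms by simp
  let ?L = "max M (- ln x)"
  have "x * 1 \<le> x * log_factor M A x" using x log_factor_ge_1 by (intro mult_left_mono) auto
  hence "x \<le> B / N" using le by linarith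
  hence "ln x \<le> ln (B / N)" using x by simp
  hence "ln N \<le> ?L + ln B" using B N by (simp add: ln_div)
  also have "\<dots> \<le> ?L * (1 + ln B)" using M B mult_right_mono[of 1 ?L "ln B"] by (simp add: algebra_simps)
  finally have "ln N powr A \<le> (?L * (1 + ln B)) powr A" using N A by (intro powr_mono2) auto
  also have "\<dots> = log_factor M A x * (1 + ln B) powr A"
    unfolding log_factor_def by (rule powr_mult)
  finally have "x * ln N powr A \<le> x * log_factor M A x * (1 + ln B) powr A"
    using x by (simp add: mult.assoc mult_left_mono)
  also have "\<dots> \<le> B / N * (1 + ln B) powr A" using le by (rule mult_right_mono) simp
  finally show ?thesis using N by (simp add: field_simps)
qed

text \<open>
  Only the nonzero components may be used: at a zero component the weight is \<open>1\<close>, whose factor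
  \<open>M^A\<close> exceeds the dominating weight \<open>1\<close> in general.  So at least one nonzero component is
  required.
\<close>

lemma prod_weight_mult_log_factor_le:
  assumes k: "k j0 \<noteq> 0" "j0 \<in> {1..d}"
    and zero: "\<And>j. j \<in> {1..d} \<Longrightarrow> \<rho> j 0 = 1" "\<And>j. j \<in> {1..d} \<Longrightarrow> \<omega> j 0 = 1"
    and pos: "\<And>j m. j \<in> {1..d} \<Longrightarrow> \<rho> j m > 0"
    and le: "\<And>j m. j \<in> {1..d} \<Longrightarrow> m \<noteq> 0 \<Longrightarrow> \<rho> j m * log_factor M A (\<rho> j m) \<le> \<omega> j m"
  shows "prod_weight \<rho> d k * log_factor M A (prod_weight \<rho> d k) \<le> prod_weight \<omega> d k"
proof -
  let ?J = "{j \<in> {1..d}. k j \<noteq> 0}"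
  have \<rho>: "prod_weight \<rho> d k = (\<Prod>j\<in>?J. \<rho> j (k j))"
    unfolding prod_weight_def by (rule prod.mono_neutral_right) (use zero in auto)
  have \<omega>: "prod_weight \<omega> d k = (\<Prod>j\<in>?J. \<omega> j (k j))"
    unfolding prod_weight_def by (rule prod.mono_neutral_right) (use zero in auto)
  have "prod_weight \<rho> d k * log_factor M A (prod_weight \<rho> d k) \<le>
      (\<Prod>j\<in>?J. \<rho> j (k j)) * (\<Prod>j\<in>?J. log_factor M A (\<rho> j (k j)))"
    unfolding \<rho> by (intro mult_left_mono log_factor_prod_le prod_nonneg)
      (use k pos in \<open>auto intro: less_imp_le\<close>)
  also have "\<dots> = (\<Prod>j\<in>?J. \<rho> j (k j) * log_factor M A (\<rho> j (k j)))"
    by (rule prod.distrib[symmetric])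
  also have "\<dots> \<le> (\<Prod>j\<in>?J. \<omega> j (k j))"
  proof (rule prod_mono, safe)
    fix j assume j: "j \<in> {1..d}" "k j \<noteq> 0"
    show "0 \<le> \<rho> j (k j) * log_factor M A (\<rho> j (k j))"
      using pos[of j "k j"] j log_factor_ge_1[of "\<rho> j (k j)"] by (intro mult_nonneg_nonneg) linarith+
    show "\<rho> j (k j) * log_factor M A (\<rho> j (k j)) \<le> \<omega> j (k j)" using j by (intro le)
  qed
  finally show ?thesis by (simp add: \<omega>)
qed

text \<open>
  The minimal increment is at most every increment, so \<open>\<phi>\<close> of it is at most the mean over the
  candidates of \<open>\<phi>\<close> of the increments, and this is at most the mean of the dominating sums.  The resulting bound
  for component \<open>d + 1\<close> is the difference of two consecutive products, and subadditivity of \<open>\<phi>\<close>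
  adds these differences up.
\<close>

lemma greedy_dual_sum_bound:
  fixes \<rho> \<omega> :: "nat \<Rightarrow> int \<Rightarrow> real"
  assumes N: "prime N"
    and pos: "\<And>j m. j \<in> {1..s} \<Longrightarrow> \<rho> j m > 0"
    and zero: "\<And>j. j \<in> {1..s} \<Longrightarrow> \<rho> j 0 = 1" "\<And>j. j \<in> {1..s} \<Longrightarrow> \<omega> j 0 = 1"
    and \<rho>_sum: "\<And>j. j \<in> {1..s} \<Longrightarrow> \<rho> j summable_on UNIV"
    and \<omega>_sum: "\<And>j. j \<in> {1..s} \<Longrightarrow> (\<omega> j has_sum (1 + \<sigma> j)) UNIV"
    and decay: "\<And>j m. j \<in> {1..s} \<Longrightarrow> m \<noteq> 0 \<Longrightarrow> \<omega> j (int N * m) \<le> \<omega> j m / real N"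
    and le: "\<And>j m. j \<in> {1..s} \<Longrightarrow> m \<noteq> 0 \<Longrightarrow> \<rho> j m * log_factor M A (\<rho> j m) \<le> \<omega> j m"
    and greedy: "\<And>d h. d < s \<Longrightarrow> h \<in> {1..N - 1} \<Longrightarrow>
      new_sum \<rho> d N g (g (Suc d)) \<le> new_sum \<rho> d N g h"
  shows "dual_sum \<rho> s N g * log_factor M A (dual_sum \<rho> s N g)
    \<le> 2 / real (N - 1) * ((\<Prod>j=1..s. 1 + \<sigma> j) - 1)"
proof -
  have N1: "N - 1 > 0" using prime_gt_1_nat[OF N] by simp
  have \<omega>_nonneg: "\<omega> j m \<ge> 0" if "j \<in> {1..s}" for j m
  proof (cases "m = 0")
    case False
    have "0 \<le> \<rho> j m * log_factor M A (\<rho> j m)"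
      using pos[OF that, of m] log_factor_ge_1[of "\<rho> j m"] by (intro mult_nonneg_nonneg) linarith+
    thus ?thesis using le[OF that False] by linarith
  qed (use zero that in auto)
  have W\<rho>: "prod_weight \<rho> d summable_on freqs d" if "d \<le> s" for d
    by (rule has_sum_imp_summable[OF has_sum_prod_weight[OF has_sum_infsum[OF \<rho>_sum]]])
       (use that pos in \<open>auto intro: less_imp_le\<close>)
  have W\<omega>: "prod_weight \<omega> d summable_on freqs d" if "d \<le> s" for d
    by (rule has_sum_imp_summable[OF has_sum_prod_weight[OF \<omega>_sum]])
       (use that \<omega>_nonneg in auto)
  have W_pos: "prod_weight \<rho> d k > 0" if "d \<le> s" for d k
    unfolding prod_weight_def using that pos by (intro prod_pos) auto
  let ?\<phi> = "\<lambda>x. x * log_factor M A x"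
  have step: "?\<phi> (new_sum \<rho> d N g (g (Suc d))) \<le> 2 / real (N - 1) * (\<sigma> (Suc d) * (\<Prod>j=1..d. 1 + \<sigma> j))"
    if d: "d < s" for d
  proof -
    have new_le: "?\<phi> (new_sum \<rho> d N g h) \<le> new_sum \<omega> d N g h" for h
      unfolding new_sum_def
    proof (rule mult_log_factor_infsum_le)
      have sub: "new_freqs d N g h \<subseteq> freqs (Suc d)" by (auto simp: new_freqs_def)
      show "prod_weight \<rho> (Suc d) summable_on new_freqs d N g h"
        using d by (intro summable_on_subset[OF W\<rho> sub]) auto
      show "prod_weight \<omega> (Suc d) summable_on new_freqs d N g h"
        using d by (intro summable_on_subset[OF W\<omega> sub]) auto
      fix k assume k: "k \<in> new_freqs d N g h"
      show "prod_weight \<rho> (Suc d) k > 0" using W_pos d by simp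
      show "?\<phi> (prod_weight \<rho> (Suc d) k) \<le> prod_weight \<omega> (Suc d) k"
        by (rule prod_weight_mult_log_factor_le[where ?j0.0 = "Suc d"])
           (use d k zero pos le in \<open>auto simp: new_freqs_def\<close>)
    qed
    have new_nonneg: "new_sum \<rho> d N g h \<ge> 0" for h
      unfolding new_sum_def using W_pos[of "Suc d"] d by (intro infsum_nonneg) (auto intro: less_imp_le)
    have "real (N - 1) * ?\<phi> (new_sum \<rho> d N g (g (Suc d))) = (\<Sum>h=1..N-1. ?\<phi> (new_sum \<rho> d N g (g (Suc d))))"
      by simp
    also have "\<dots> \<le> (\<Sum>h=1..N-1. new_sum \<omega> d N g h)"
      using greedy[OF d] new_nonneg
      by (intro sum_mono order_trans[OF mult_log_factor_mono new_le]) auto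
    also have "\<dots> \<le> 2 * \<sigma> (Suc d) * (\<Prod>j=1..d. 1 + \<sigma> j)"
      by (rule sum_new_sum_le[OF N]) (use d \<omega>_sum \<omega>_nonneg zero decay in auto)
    finally show ?thesis using N1 by (simp add: field_simps)
  qed
  have dual_nonneg: "dual_sum \<rho> d N g \<ge> 0" if "d \<le> s" for d
    unfolding dual_sum_def using W_pos[OF that] by (intro infsum_nonneg) (auto intro: less_imp_le)
  have "?\<phi> (dual_sum \<rho> d N g) \<le> 2 / real (N - 1) * ((\<Prod>j=1..d. 1 + \<sigma> j) - 1)" if "d \<le> s" for d
    using that
  proof (induction d)
    case (Suc d)
    have new_nonneg: "new_sum \<rho> d N g (g (Suc d)) \<ge> 0"
      unfolding new_sum_def using W_pos[OF Suc.prems] by (intro infsum_nonneg) (auto intro: less_imp_le)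
    have "?\<phi> (dual_sum \<rho> (Suc d) N g) =
        ?\<phi> (dual_sum \<rho> d N g + new_sum \<rho> d N g (g (Suc d)))"
      using dual_sum_Suc[OF W\<rho>[OF Suc.prems]] zero Suc.prems by simp
    also have "\<dots> \<le> ?\<phi> (dual_sum \<rho> d N g) + ?\<phi> (new_sum \<rho> d N g (g (Suc d)))"
      by (rule mult_log_factor_add_le) (use dual_nonneg new_nonneg Suc.prems in auto)
    also have "\<dots> \<le> 2 / real (N - 1) * ((\<Prod>j=1..d. 1 + \<sigma> j) - 1) +
        2 / real (N - 1) * (\<sigma> (Suc d) * (\<Prod>j=1..d. 1 + \<sigma> j))"
      using Suc step[of d] by (intro add_mono) auto
    also have "\<dots> = 2 / real (N - 1) * ((\<Prod>j=1..Suc d. 1 + \<sigma> j) - 1)"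
      by (simp add: algebra_simps add_divide_distrib diff_divide_distrib)
    finally show ?case .
  qed simp
  thus ?thesis by simp
qed

end

section \<open>One-dimensional logarithmic weights\<close>

text \<open>
  At \<open>m = 0\<close> the value is \<open>0\<close>, since the inverse of zero is zero; sums over all integers are
  therefore sums over the nonzero ones.
\<close>

definition log_decay :: "real \<Rightarrow> real \<Rightarrow> int \<Rightarrow> real" where
  "log_decay \<kappa> p m = inverse \<bar>real_of_int m\<bar> * ln (\<kappa> * \<bar>real_of_int m\<bar>) powr (- p)"

lemma log_decay_nonneg [simp]: "log_decay \<kappa> p m \<ge> 0"
  by (simp add: log_decay_def)

lemma ln_powr_minus_antimono:
  assumes "\<kappa> > 1" "p \<ge> 0" "m \<ge> 1" "real_of_int m \<le> real_of_int n"
  shows "ln (\<kappa> * \<bar>real_of_int n\<bar>) powr (- p) \<le> ln (\<kappa> * \<bar>real_of_int m\<bar>) powr (- p)"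
proof -
  have "1 < \<kappa> * real_of_int m" using assms less_le_trans[of 1 \<kappa> "\<kappa> * real_of_int m"] by simp
  thus ?thesis using assms by (intro powr_mono2') auto
qed

lemma log_decay_mult_le:
  assumes "\<kappa> > 1" "p \<ge> 0" "m \<noteq> 0" "N > 0"
  shows "log_decay \<kappa> p (int N * m) \<le> log_decay \<kappa> p m / real N"
proof -
  have "1 * \<bar>real_of_int m\<bar> \<le> real N * \<bar>real_of_int m\<bar>" using assms by (intro mult_right_mono) auto
  hence "ln (\<kappa> * \<bar>real_of_int (int N * m)\<bar>) powr (- p) \<le> ln (\<kappa> * \<bar>real_of_int m\<bar>) powr (- p)"
    using ln_powr_minus_antimono[of \<kappa> p "\<bar>m\<bar>" "\<bar>int N * m\<bar>"] assms by (simp add: abs_mult)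
  hence "inverse (real N * \<bar>real_of_int m\<bar>) * ln (\<kappa> * \<bar>real_of_int (int N * m)\<bar>) powr (- p) \<le>
     inverse (real N * \<bar>real_of_int m\<bar>) * ln (\<kappa> * \<bar>real_of_int m\<bar>) powr (- p)"
    by (intro mult_left_mono) auto
  thus ?thesis by (simp add: log_decay_def abs_mult divide_inverse mult_ac)
qed

text \<open>
  By Cauchy condensation, since \<open>ln (\<kappa> 2^n) \<ge> n ln 2\<close>.
\<close>

lemma log_decay_summable:
  assumes \<kappa>: "\<kappa> > 1" and p: "p > 1"
  shows "log_decay \<kappa> p summable_on UNIV"
proof -
  let ?f = "\<lambda>n::nat. log_decay \<kappa> p (int n)"
  have "summable (\<lambda>n. 2 ^ n * ?f (2 ^ n))"
  proof (rule summable_comparison_test')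
    show "summable (\<lambda>n. ln 2 powr (- p) * real n powr (- p))"
      using p by (intro summable_mult) (simp add: summable_real_powr_iff)
    fix n :: nat assume n: "n \<ge> 1"
    have "ln (\<kappa> * 2 ^ n) powr (- p) \<le> (real n * ln 2) powr (- p)"
      using n p \<kappa> by (intro powr_mono2') (auto simp: ln_mult ln_realpow)
    moreover have "2 ^ n * ?f (2 ^ n) = ln (\<kappa> * 2 ^ n) powr (- p)"
      by (simp add: log_decay_def)
    ultimately show "norm (2 ^ n * ?f (2 ^ n)) \<le> ln 2 powr (- p) * real n powr (- p)"
      by (simp add: powr_mult mult.commute)
  qed
  hence "summable ?f"
  proof (subst condensation_test)
    fix m :: nat assume m: "0 < m"
    show "?f (Suc m) \<le> ?f m"
      unfolding log_decay_def using m p \<kappa> ln_powr_minus_antimono[of \<kappa> p "int m" "int (Suc m)"]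
      by (intro mult_mono le_imp_inverse_le) auto
  qed auto
  hence nat: "?f summable_on UNIV" by (simp add: summable_on_UNIV_nonneg_real_iff)
  have "log_decay \<kappa> p summable_on range int"
    using nat by (subst summable_on_reindex) (auto simp: o_def)
  moreover have "log_decay \<kappa> p summable_on range (\<lambda>n. - int n)"
    using nat by (subst summable_on_reindex) (auto simp: o_def inj_on_def log_decay_def)
  ultimately have "log_decay \<kappa> p summable_on (range int \<union> range (\<lambda>n. - int n))"
    by (rule summable_on_union)
  also have "range int \<union> range (\<lambda>n. - int n) = UNIV"
    by (auto simp: image_iff) (metis int_cases2)
  finally show ?thesis .
qed

lemma has_sum_weight_log_decay:
  assumes "\<kappa> > 1" "p > 1"
  shows "((\<lambda>m. if m = 0 then 1 else c * log_decay \<kappa> p m) has_sum (1 + c * infsum (log_decay \<kappa> p) UNIV)) UNIV"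
proof -
  have "((\<lambda>m::int. if m = 0 then 1 else 0::real) has_sum 1) UNIV"
    by (subst has_sum_cong_neutral[where T = "{0}" and g = "\<lambda>_. 1"]) (auto simp: has_sum_finite_iff)
  from has_sum_add[OF this has_sum_cmult_right[OF has_sum_infsum[OF log_decay_summable[OF assms]], of c]]
  show ?thesis by (rule has_sum_cong[THEN iffD1, rotated]) (auto simp: log_decay_def)
qed

text \<open>
  With \<open>l = ln (\<kappa> |m|) \<ge> 1\<close>, the negative logarithm of the weight is
  \<open>ln (1/c) + ln |m| + \<mu> ln l\<close>, at most a multiple of \<open>max(1, ln(1/c)) l\<close>.  The comparison
  function therefore costs \<open>A\<close> powers of \<open>l\<close> and puts \<open>max(1, ln(1/c))^A\<close> on the coefficient.
\<close>

lemma korobov_r1_mult_log_factor_le: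
  assumes \<kappa>: "\<kappa> \<ge> exp 1" and \<mu>: "\<mu> > 0" and A: "A \<ge> 0" and c: "c > 0" and m: "m \<noteq> 0"
  shows "korobov_r1 \<kappa> \<mu> c m * log_factor (1 + \<mu>) A (korobov_r1 \<kappa> \<mu> c m) \<le>
    (2 + \<mu>) powr A * (c * max 1 (ln (inverse c)) powr A) * log_decay \<kappa> (\<mu> - A) m"
proof -
  let ?G = "max 1 (ln (inverse c))" and ?m = "\<bar>real_of_int m\<bar>" and ?l = "ln (\<kappa> * \<bar>real_of_int m\<bar>)"
  let ?r = "korobov_r1 \<kappa> \<mu> c m"
  have m1: "?m \<ge> 1" using m by linarith
  have \<kappa>0: "\<kappa> > 0" using \<kappa> exp_gt_zero[of 1] by linarith
  have \<kappa>1: "ln \<kappa> \<ge> 1" using \<kappa> \<kappa>0 by (simp add: ln_ge_iff)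
  have l: "?l = ln \<kappa> + ln ?m" using \<kappa>0 m1 by (simp add: ln_mult)
  have lnm: "ln ?m \<ge> 0" using m1 by simp
  have l1: "?l \<ge> 1" using l lnm \<kappa>1 by linarith
  have r: "?r = c * inverse ?m * ?l powr (- \<mu>)" using m by (simp add: korobov_r1_def)
  have r0: "?r > 0" using c m1 l1 unfolding r by (intro mult_pos_pos) auto
  have "ln ?r = ln (c * inverse ?m) + ln (?l powr (- \<mu>))"
    unfolding r using c m1 l1 by (intro ln_mult_pos) auto
  also have "ln (c * inverse ?m) = ln c + ln (inverse ?m)"
    using c m1 by (intro ln_mult_pos) auto
  finally have "- ln ?r = ln (inverse c) + ln ?m + \<mu> * ln ?l"
    using c m1 l1 by (simp add: ln_inverse ln_powr)
  also have "\<dots> \<le> ?G + ?l + \<mu> * ?l"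
    using l \<kappa>1 \<mu> ln_bound[of ?l] l1 by (intro add_mono mult_left_mono) auto
  also have "\<dots> = ?G + (1 + \<mu>) * ?l" by (simp add: algebra_simps)
  also have "\<dots> \<le> ?G * ?l + (1 + \<mu>) * (?G * ?l)"
    using l1 \<mu> mult_left_mono[of 1 ?l ?G] mult_right_mono[of 1 ?G ?l]
    by (intro add_mono mult_left_mono) auto
  also have "\<dots> = (2 + \<mu>) * (?G * ?l)" by (simp add: algebra_simps)
  finally have 1: "- ln ?r \<le> (2 + \<mu>) * (?G * ?l)" .
  have "1 * 1 \<le> ?G * ?l" using l1 by (intro mult_mono) auto
  hence "(1 + \<mu>) * 1 \<le> (2 + \<mu>) * (?G * ?l)" using \<mu> by (intro mult_mono) auto
  hence "max (1 + \<mu>) (- ln ?r) \<le> (2 + \<mu>) * (?G * ?l)" using 1 by simp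
  hence "log_factor (1 + \<mu>) A ?r \<le> ((2 + \<mu>) * (?G * ?l)) powr A"
    unfolding log_factor_def using \<mu> A by (intro powr_mono2) auto
  also have "\<dots> = (2 + \<mu>) powr A * (?G powr A * ?l powr A)"
    using \<mu> l1 by (simp add: powr_mult)
  finally have "?r * log_factor (1 + \<mu>) A ?r \<le> ?r * ((2 + \<mu>) powr A * (?G powr A * ?l powr A))"
    using r0 by (intro mult_left_mono) auto
  also have "\<dots> = (2 + \<mu>) powr A * (c * ?G powr A) * (inverse ?m * (?l powr (- \<mu>) * ?l powr A))"
    by (simp add: r)
  also have "?l powr (- \<mu>) * ?l powr A = ?l powr (- (\<mu> - A))"
    by (simp add: powr_add[symmetric])
  finally show ?thesis by (simp add: log_decay_def)
qed

lemma korobov_r1_pos: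
  assumes "\<kappa> > 1" "c > 0"
  shows "korobov_r1 \<kappa> \<mu> c m > 0"
proof (cases "m = 0")
  case False
  hence "1 \<le> \<bar>real_of_int m\<bar>" by linarith
  hence "1 < \<kappa> * \<bar>real_of_int m\<bar>" using assms mult_left_mono[of 1 "\<bar>real_of_int m\<bar>" \<kappa>] by linarith
  thus ?thesis using assms False by (auto simp: korobov_r1_def intro!: mult_pos_pos)
qed (simp add: korobov_r1_def)

lemma korobov_r1_has_sum:
  assumes "\<kappa> > 1" "\<mu> > 1"
  shows "(korobov_r1 \<kappa> \<mu> c has_sum (1 + c * infsum (log_decay \<kappa> \<mu>) UNIV)) UNIV"
  using has_sum_weight_log_decay[OF assms, of c]
  by (rule has_sum_cong[THEN iffD1, rotated]) (auto simp: korobov_r1_def log_decay_def)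

section \<open>The component-by-component bound\<close>

lemma prod_one_plus_le_exp_sum:
  fixes x :: "'a \<Rightarrow> real"
  assumes "\<And>j. j \<in> J \<Longrightarrow> x j \<ge> 0"
  shows "(\<Prod>j\<in>J. 1 + x j) \<le> exp (\<Sum>j\<in>J. x j)"
proof (cases "finite J")
  case True
  thus ?thesis unfolding exp_sum[OF True] using assms by (intro prod_mono) (auto intro: add_nonneg_nonneg)
qed simp

lemma lattice_error_sq_korobov:
  assumes "\<kappa> > 1" "\<mu> > 1" "\<And>j. j \<ge> 1 \<Longrightarrow> \<gamma> j > 0" "N > 0"
  shows "(lattice_error \<kappa> \<mu> \<gamma> s N g)\<^sup>2 = dual_sum (\<lambda>j. korobov_r1 \<kappa> \<mu> (\<gamma> j)) s N g"
proof -
  interpret positive_summable_korobov \<kappa> \<mu> \<gamma> s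
  proof
    show "korobov_r \<kappa> \<mu> \<gamma> s k > 0" for k
      unfolding korobov_r_def using assms by (intro prod_pos) (auto intro: korobov_r1_pos)
    show "korobov_r \<kappa> \<mu> \<gamma> s summable_on freqs s"
      unfolding korobov_r_eq_prod_weight
      by (rule has_sum_imp_summable[OF has_sum_prod_weight[OF korobov_r1_has_sum]])
         (use assms in \<open>auto intro: less_imp_le[OF korobov_r1_pos]\<close>)
  qed
  show ?thesis by (rule lattice_error_sq_eq_dual_sum[OF assms(4)])
qed

text \<open>
  The candidates share all earlier components, so their squared errors differ by the increments
  only.  The first component is covered because all first increments coincide.
\<close>

lemma cbc_generated_new_sum_le:
  assumes \<kappa>: "\<kappa> > 1" and \<mu>: "\<mu> > 1" and \<gamma>: "\<And>j. j \<ge> 1 \<Longrightarrow> \<gamma> j > 0" and N: "prime N"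
    and cbc: "cbc_generated \<kappa> \<mu> \<gamma> s N g" and d: "d < s" and h: "h \<in> {1..N - 1}"
  shows "new_sum (\<lambda>j. korobov_r1 \<kappa> \<mu> (\<gamma> j)) d N g (g (Suc d)) \<le>
    new_sum (\<lambda>j. korobov_r1 \<kappa> \<mu> (\<gamma> j)) d N g h"
proof (cases "d = 0")
  case True
  have "g (Suc 0) = 1" "(1::nat) \<in> {1..N - 1}"
    using cbc prime_ge_2_nat[OF N] by (auto simp: cbc_generated_def)
  thus ?thesis using True new_sum_first_component[OF N _ h] by simp
next
  case False
  let ?\<rho> = "\<lambda>j. korobov_r1 \<kappa> \<mu> (\<gamma> j)"
  have N0: "N > 0" using N prime_gt_0_nat by blast
  note error = lattice_error_sq_korobov[OF \<kappa> \<mu> \<gamma> N0, where s = "Suc d"]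
  have "prod_weight ?\<rho> (Suc d) summable_on freqs (Suc d)"
    by (rule has_sum_imp_summable[OF has_sum_prod_weight[OF korobov_r1_has_sum]])
       (use \<kappa> \<mu> \<gamma> in \<open>auto intro: less_imp_le[OF korobov_r1_pos]\<close>)
  note dual = dual_sum_Suc[of ?\<rho>, OF this]
  have "(lattice_error \<kappa> \<mu> \<gamma> (Suc d) N g)\<^sup>2 \<le> (lattice_error \<kappa> \<mu> \<gamma> (Suc d) N (g(Suc d := h)))\<^sup>2"
    using cbc d h False by (simp add: cbc_generated_def)
  hence "dual_sum ?\<rho> (Suc d) N g \<le> dual_sum ?\<rho> (Suc d) N (g(Suc d := h))"
    by (simp only: error)
  thus ?thesis by (simp add: dual korobov_r1_def)
qed

theorem theorem4:
  fixes \<mu> lam \<kappa> \<Gamma> :: real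
  assumes "\<mu> > 1" and "1 / \<mu> < lam" and "lam \<le> 1"
  shows "\<exists>c>0. \<forall>\<gamma> :: nat \<Rightarrow> real.
    (\<forall>j\<ge>1. \<gamma> j > 0) \<longrightarrow>
    (\<forall>j\<ge>1. \<kappa> \<ge> max (exp (exp 2)) (exp (exp 2 * \<gamma> j powr (1 / \<mu>)))) \<longrightarrow>
    ((\<lambda>j. \<gamma> (Suc j) * max 1 (ln (inverse (\<gamma> (Suc j)))) powr (\<mu> * (1 - lam))) sums \<Gamma>) \<longrightarrow>
    (\<forall>s\<ge>1. \<forall>N g. prime N \<longrightarrow> cbc_generated \<kappa> \<mu> \<gamma> s N g \<longrightarrow>
      (lattice_error \<kappa> \<mu> \<gamma> s N g)\<^sup>2 \<le> c / (real N * ln (real N) powr (\<mu> * (1 - lam))))"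
proof -
  define A where "A = \<mu> * (1 - lam)"
  define C where "C = (2 + \<mu>) powr A * infsum (log_decay \<kappa> (\<mu> - A)) UNIV"
  \<comment> \<open>the constant must be chosen before \<open>\<Gamma>\<close> is known to be a sum of positive terms, hence the absolute value\<close>
  define B where "B = 4 * exp (C * \<bar>\<Gamma>\<bar>)"
  have A: "A \<ge> 0" "A \<le> 1 + \<mu>" "\<mu> - A > 1"
  proof -
    have "1 < \<mu> * lam" using assms by (simp add: field_simps)
    thus "A \<ge> 0" "A \<le> 1 + \<mu>" "\<mu> - A > 1"
      using assms by (auto simp: A_def algebra_simps)
  qed
  have C: "C \<ge> 0" unfolding C_def by (intro mult_nonneg_nonneg infsum_nonneg) auto
  have "1 \<le> exp (C * \<bar>\<Gamma>\<bar>)" using C by simp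
  hence B: "B \<ge> 1" unfolding B_def by linarith
  have M: "2 \<le> 1 + \<mu>" using assms by simp
  show ?thesis
  proof (intro exI[of _ "B * (1 + ln B) powr A"] conjI allI impI)
    have "1 + ln B > 0" using ln_ge_zero[OF B] by linarith
    thus "B * (1 + ln B) powr A > 0" using B by simp
  next
    fix \<gamma> :: "nat \<Rightarrow> real" and s N :: nat and g :: "nat \<Rightarrow> nat"
    assume \<gamma>: "\<forall>j\<ge>1. \<gamma> j > 0"
      and \<kappa>: "\<forall>j\<ge>1. \<kappa> \<ge> max (exp (exp 2)) (exp (exp 2 * \<gamma> j powr (1 / \<mu>)))"
      and \<Gamma>: "(\<lambda>j. \<gamma> (Suc j) * max 1 (ln (inverse (\<gamma> (Suc j)))) powr (\<mu> * (1 - lam))) sums \<Gamma>"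
      and N: "prime N" and cbc: "cbc_generated \<kappa> \<mu> \<gamma> s N g"
    let ?G = "\<lambda>j. \<gamma> j * max 1 (ln (inverse (\<gamma> j))) powr A"
    let ?\<rho> = "\<lambda>j. korobov_r1 \<kappa> \<mu> (\<gamma> j)"
    define c where "c j = (2 + \<mu>) powr A * ?G j" for j
    define \<omega> where "\<omega> j m = (if m = 0 then 1 else c j * log_decay \<kappa> (\<mu> - A) m)" for j m
    have N1: "N > 1" using N prime_gt_1_nat by blast
    have "exp 1 \<le> exp (exp (2::real))" using exp_ge_add_one_self[of "2::real"] by simp
    moreover have "exp (exp 2) \<le> \<kappa>" using \<kappa> by auto
    ultimately have \<kappa>e: "\<kappa> \<ge> exp 1" by linarith
    have \<kappa>1: "\<kappa> > 1" using \<kappa>e one_less_exp_iff[of "1::real"] by linarith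
    have c_nonneg: "c j \<ge> 0" if "j \<ge> 1" for j
      using \<gamma> that unfolding c_def by (intro mult_nonneg_nonneg) (auto intro: less_imp_le)
    have \<rho>_sum: "(?\<rho> j has_sum (1 + \<gamma> j * infsum (log_decay \<kappa> \<mu>) UNIV)) UNIV" for j
      by (rule korobov_r1_has_sum[OF \<kappa>1 assms(1)])
    have \<omega>_sum: "(\<omega> j has_sum (1 + c j * infsum (log_decay \<kappa> (\<mu> - A)) UNIV)) UNIV" for j
      unfolding \<omega>_def using A by (intro has_sum_weight_log_decay \<kappa>1)
    have "dual_sum ?\<rho> s N g * log_factor (1 + \<mu>) A (dual_sum ?\<rho> s N g)
        \<le> 2 / real (N - 1) * ((\<Prod>j=1..s. 1 + c j * infsum (log_decay \<kappa> (\<mu> - A)) UNIV) - 1)"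
    proof (rule greedy_dual_sum_bound[OF M A(1,2) N, where \<omega> = \<omega>])
      show "?\<rho> j m > 0" if "j \<in> {1..s}" for j m using korobov_r1_pos[OF \<kappa>1] \<gamma> that by simp
      show "\<omega> j (int N * m) \<le> \<omega> j m / real N" if "j \<in> {1..s}" "m \<noteq> 0" for j m
        using log_decay_mult_le[OF \<kappa>1, of "\<mu> - A" m N] A(3) N1 that c_nonneg[of j]
        by (auto simp: \<omega>_def dest: mult_left_mono[of _ _ "c j"])
      show "?\<rho> j m * log_factor (1 + \<mu>) A (?\<rho> j m) \<le> \<omega> j m" if "j \<in> {1..s}" "m \<noteq> 0" for j m
        using korobov_r1_mult_log_factor_le[OF \<kappa>e _ A(1) _ that(2), of \<mu> "\<gamma> j"] \<gamma> assms(1) that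
        by (simp add: \<omega>_def c_def)
      show "new_sum ?\<rho> d N g (g (Suc d)) \<le> new_sum ?\<rho> d N g h" if "d < s" "h \<in> {1..N - 1}" for d h
        using \<gamma> that by (intro cbc_generated_new_sum_le[OF \<kappa>1 assms(1) _ N cbc]) auto
    qed (use \<rho>_sum \<omega>_sum in \<open>auto simp: \<omega>_def korobov_r1_def dest: has_sum_imp_summable\<close>)
    \<comment> \<open>\<open>N / 2 \<le> N - 1\<close>\<close>
    also have "\<dots> \<le> 4 / real N * (\<Prod>j=1..s. 1 + c j * infsum (log_decay \<kappa> (\<mu> - A)) UNIV)"
    proof (rule mult_mono)
      show "2 / real (N - 1) \<le> 4 / real N" using N1 by (simp add: field_simps of_nat_diff)
      show "0 \<le> (\<Prod>j=1..s. 1 + c j * infsum (log_decay \<kappa> (\<mu> - A)) UNIV) - 1"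
        using c_nonneg by (auto intro!: prod_ge_1 mult_nonneg_nonneg infsum_nonneg)
    qed (use N1 in auto)
    also have "(\<Prod>j=1..s. 1 + c j * infsum (log_decay \<kappa> (\<mu> - A)) UNIV) \<le> exp (C * \<bar>\<Gamma>\<bar>)"
    proof -
      have "(\<Prod>j=1..s. 1 + c j * infsum (log_decay \<kappa> (\<mu> - A)) UNIV)
          \<le> exp (\<Sum>j=1..s. c j * infsum (log_decay \<kappa> (\<mu> - A)) UNIV)"
        using c_nonneg by (intro prod_one_plus_le_exp_sum) (auto intro!: mult_nonneg_nonneg infsum_nonneg)
      also have "(\<Sum>j=1..s. c j * infsum (log_decay \<kappa> (\<mu> - A)) UNIV) = C * (\<Sum>j=1..s. ?G j)"
        by (simp add: C_def c_def sum_distrib_left mult_ac)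
      also have "(\<Sum>j=1..s. ?G j) = (\<Sum>j<s. ?G (Suc j))"
        by (simp add: sum.atLeast1_atMost_eq)
      also have "\<dots> \<le> (\<Sum>j. ?G (Suc j))"
        using \<Gamma> \<gamma> by (intro sum_le_suminf) (auto simp: A_def sums_iff less_imp_le)
      also have "\<dots> = \<Gamma>" using \<Gamma> by (simp add: A_def sums_iff)
      also have "\<Gamma> \<le> \<bar>\<Gamma>\<bar>" by simp
      finally show ?thesis using C by (simp add: mult_left_mono)
    qed
    finally have "dual_sum ?\<rho> s N g * log_factor (1 + \<mu>) A (dual_sum ?\<rho> s N g) \<le> B / real N"
      using N1 by (simp add: B_def field_simps)
    moreover have error: "(lattice_error \<kappa> \<mu> \<gamma> s N g)\<^sup>2 = dual_sum ?\<rho> s N g"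
      using \<gamma> N1 by (intro lattice_error_sq_korobov[OF \<kappa>1 assms(1)]) auto
    moreover have "dual_sum ?\<rho> s N g \<ge> 0" by (simp flip: error)
    ultimately show "(lattice_error \<kappa> \<mu> \<gamma> s N g)\<^sup>2 \<le>
        B * (1 + ln B) powr A / (real N * ln (real N) powr (\<mu> * (1 - lam)))"
      using le_of_mult_log_factor_le[OF M A(1,2) _ B, of "dual_sum ?\<rho> s N g" "real N"] N1
      by (simp add: A_def)
  qed
qed

end
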